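(* For any positive constants $A$ and $\alpha$ there is a positive constant $A'$ such that the following holds. Let $0<\mu\le1$, let $n$ be sufficiently large (depending on $A,\alpha,\mu$), and let $\mathbf v=\{v_1,\dots,v_n\}$ be a multiset of integers satisfying $\mathbb P_\mu(\mathbf v)\ge n^{-A}$. Then there is a generalized arithmetic progression $Q$ of rank at most $A'$ and volume at most $n^{A'}$ which contains all but at most $n^\alpha$ elements of $\mathbf v$ (counting multiplicity). Furthermore, there exists a positive integer $s\le n^{A'}$ such that $su\in\mathbf v$ for each generator $u$ of $Q$.
   Context: For $0\le\mu\le1$, $\eta^\mu$ is a random variable equal to $0$ with probability $1-\mu$ and to $+1$, $-1$ with probability $\mu/2$ each. For a multiset $\mathbf v=\{v_1,\dots,v_n\}$ of integers, $\mathbb P_\mu(\mathbf v):=\max_{a\in\mathbb Z}\mathbf P(\sum_{i=1}^n\eta_i^\mu v_i=a)$, where the $\eta^\mu_i$ are i.i.d. copies of $\eta^\mu$. A generalized arithmetic progression (GAP) of rank $d$ is a set $P=\{c+m_1a_1+\dots+m_da_d: m_i\in\mathbb Z,\ M_i\le m_i\le M_i'\}$ (given together with this presentation, $M_i\le M_i'$ integers). The numbers $a_i$ are its generators (all GAPs here have rational generators), and its volume is $\prod_{i=1}^d(M_i'-M_i+1)$. A rank $0$ GAP is a single point, with volume $1$ and no generators. *)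

theory Defs
  imports "HOL-Probability.Product_PMF"
begin

text \<open>The law of \<open>\<eta>\<^sup>\<mu>\<close>, meaningful for \<open>0 \<le> \<mu> \<le> 1\<close>.\<close>

definition lazy_sign_pmf :: "real \<Rightarrow> int pmf" where
  "lazy_sign_pmf \<mu> =
     bernoulli_pmf \<mu> \<bind> (\<lambda>b. if b then pmf_of_set {1, -1} else return_pmf 0)"

lemma pmf_lazy_sign:
  assumes "0 \<le> \<mu>" "\<mu> \<le> 1"
  shows "pmf (lazy_sign_pmf \<mu>) 0 = 1 - \<mu>"
    and "pmf (lazy_sign_pmf \<mu>) 1 = \<mu> / 2"
    and "pmf (lazy_sign_pmf \<mu>) (-1) = \<mu> / 2"
  using assms by (simp_all add: lazy_sign_pmf_def pmf_bind pmf_of_set)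

text \<open>A multiset \<open>{v\<^sub>1, \<dots>, v\<^sub>n}\<close> of integers is given by the family \<open>v\<close> restricted
  to the indices \<open>{1..n}\<close>, so that counting with multiplicity means counting indices.\<close>

definition conc_prob :: "real \<Rightarrow> nat \<Rightarrow> (nat \<Rightarrow> int) \<Rightarrow> real" where
  "conc_prob \<mu> n v =
     Max (range (\<lambda>a. measure_pmf.prob (Pi_pmf {1..n} 0 (\<lambda>_. lazy_sign_pmf \<mu>))
                       {\<eta>. (\<Sum>i=1..n. \<eta> i * v i) = a}))"

text \<open>The maximum is over a finite set of values, as only finitely many sums are possible.\<close>

lemma finite_conc_prob_range:
  fixes n :: nat and v :: "nat \<Rightarrow> int"
  shows
  "finite (range (\<lambda>a. measure_pmf.prob (Pi_pmf {1..n} 0 (\<lambda>_. lazy_sign_pmf \<mu>))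
                        {\<eta>. (\<Sum>i=1..n. \<eta> i * v i) = a}))"
proof -
  let ?p = "Pi_pmf {1..n} 0 (\<lambda>_. lazy_sign_pmf \<mu>)"
  let ?S = "\<lambda>\<eta>. (\<Sum>i=1..n. \<eta> i * v i)"
  let ?f = "\<lambda>a. measure_pmf.prob ?p {\<eta>. ?S \<eta> = a}"
  have "finite (set_pmf (lazy_sign_pmf \<mu>))"
    by (auto simp: lazy_sign_pmf_def intro!: finite_UN_I)
  then have "finite (set_pmf ?p)"
    by (intro finite_subset[OF set_Pi_pmf_subset' finite_PiE_dflt]) auto
  moreover have "?f a = 0" if "a \<notin> ?S ` set_pmf ?p" for a
    using that by (auto simp: measure_pmf_zero_iff)
  then have "range ?f \<subseteq> insert 0 (?f ` ?S ` set_pmf ?p)"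
    by blast
  ultimately show ?thesis
    by (meson finite_imageI finite_insert finite_subset)
qed

text \<open>A generalized arithmetic progression is kept together with its presentation: each entry
  \<open>(a\<^sub>i, M\<^sub>i, M'\<^sub>i)\<close> of \<open>gap_dims\<close> is a generator with the bounds of its coefficient.\<close>

record gap =
  gap_base :: rat
  gap_dims :: "(rat \<times> int \<times> int) list"

definition is_gap :: "gap \<Rightarrow> bool" where
  "is_gap Q \<longleftrightarrow> (\<forall>(a, M, M') \<in> set (gap_dims Q). M \<le> M')"

definition gap_rank :: "gap \<Rightarrow> nat" where
  "gap_rank Q = length (gap_dims Q)"

definition gap_gen :: "gap \<Rightarrow> nat \<Rightarrow> rat" where
  "gap_gen Q i = fst (gap_dims Q ! i)"

definition gap_lo :: "gap \<Rightarrow> nat \<Rightarrow> int" where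
  "gap_lo Q i = fst (snd (gap_dims Q ! i))"

definition gap_hi :: "gap \<Rightarrow> nat \<Rightarrow> int" where
  "gap_hi Q i = snd (snd (gap_dims Q ! i))"

definition gap_set :: "gap \<Rightarrow> rat set" where
  "gap_set Q = {gap_base Q + (\<Sum>i<gap_rank Q. of_int (m i) * gap_gen Q i) | m.
                  \<forall>i<gap_rank Q. gap_lo Q i \<le> m i \<and> m i \<le> gap_hi Q i}"

definition gap_volume :: "gap \<Rightarrow> int" where
  "gap_volume Q = (\<Prod>i<gap_rank Q. gap_hi Q i - gap_lo Q i + 1)"

end

theory Submission
  imports Defs "HOL-Real_Asymp.Real_Asymp"
begin

text \<open>
  A concentrated random sum stays concentrated when blocks of its coefficients are merged. Its
  concentration probability is at most an average over frequencies of a product of characteristic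
  functions bounded by \<open>1\<close>. By the arithmetic-geometric mean inequality the factors of any block of
  \<open>K\<close> elements can be replaced by the \<open>K\<close>-th power of the factor of one of them without decreasing
  the average (\<open>replaced_extend\<close>), and for \<open>K\<close> of order \<open>J / \<mu>\<close> this power lies below the
  Fourier transform of an explicit unimodal step distribution on \<open>[-J, J]\<close>
  (\<open>char_fun_power_le_kernel\<close>). Discarding the factors that are left shows that the walk whose steps
  are multiples of the elements \<open>w\<^sub>1, \<dots>, w\<^sub>m\<close> selected so far still returns to \<open>0\<close> with weight at
  least \<open>n powr (- A)\<close>.

  On the other hand, let \<open>q\<close> be the least positive multiplier that brings a new element into the
  set of combinations of the previous ones with coefficients at most \<open>2 J\<close> in absolute value. Two multipliers of the
  new element that allow the same end point differ by at least \<open>q\<close>, so selecting that element reduces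
  the weight to a fraction of about \<open>1 / q + 1 / sqrt J\<close> (\<open>walk_weight_Cons_le\<close>). Elements can thus
  not be selected usefully for long, and the obstruction to selecting a further one is the structure
  that is sought. Take \<open>J\<close> a small power of \<open>n\<close>.

  The first round of selection looks for elements without a bounded linear relation to
  the previous ones. Each costs a factor that is a fixed power of \<open>n\<close>, so the round ends with a
  bounded number of elements \<open>b\<^sub>1, \<dots>, b\<^sub>r\<close>, and then all but fewer than \<open>K\<close> of the remaining elements \<open>u\<close>
  satisfy \<open>D u = \<Sum> a\<^sub>i b\<^sub>i\<close> with \<open>D\<close> and the \<open>a\<^sub>i\<close> polynomially bounded
  (\<open>exists_maximal_dissociated\<close>). The denominators \<open>D\<close> still depend on \<open>u\<close>.

  The second round produces a common denominator \<open>s\<close>. As long as at least \<open>K\<close> remaining elements \<open>u\<close>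
  are such that \<open>s u\<close> is not a combination of the \<open>b\<^sub>i\<close> of the expected size, select one of them and
  multiply \<open>s\<close> by the least \<open>q\<close> that repairs this. Because the \<open>b\<^sub>i\<close> are dissociated at a much
  larger scale than the relations in use, this \<open>q\<close> bounds from below the multiplier of the previous paragraph, so the
  weight is reduced to a fraction \<open>q powr (- c)\<close>. Since the weight stays above \<open>n powr (- A)\<close>, the
  product \<open>s\<close> of all the \<open>q\<close> is polynomially bounded, and as each \<open>q\<close> is at least \<open>2\<close> the round has
  only \<open>O(log n)\<close> steps (\<open>exists_common_denominator\<close>). The progression generated by the \<open>b\<^sub>i / s\<close>
  then contains every element outside \<open>O(K log n)\<close> exceptions.

  Dissociativity is required with coefficients up to \<open>n\<close> raised to \<open>scale_exponent A \<beta> (d - r)\<close> for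
  \<open>r\<close> selected elements: the exponents decrease in \<open>r\<close> so fast that the relations found when the
  first round stops are short compared with the scale at which the selected elements are
  dissociated.
\<close>

section \<open>Averages over the frequencies of a cyclic group\<close>

definition sample_angle :: "nat \<Rightarrow> nat \<Rightarrow> real" where
  "sample_angle M t = 2 * pi * real t / real M"

definition sample_mean :: "nat \<Rightarrow> (real \<Rightarrow> real) \<Rightarrow> real" where
  "sample_mean M h = (\<Sum>t<M. h (sample_angle M t)) / real M"

lemma sample_mean_mono:
  assumes "\<And>x. h x \<le> k x"
  shows "sample_mean M h \<le> sample_mean M k"
  unfolding sample_mean_def by (intro divide_right_mono sum_mono assms) auto

lemma sample_mean_cmult: "sample_mean M (\<lambda>x. c * h x) = c * sample_mean M h"
  by (simp add: sample_mean_def sum_distrib_left)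

lemma sample_mean_sum:
  "sample_mean M (\<lambda>x. \<Sum>i\<in>A. h i x) = (\<Sum>i\<in>A. sample_mean M (h i))"
  unfolding sample_mean_def by (subst sum.swap) (simp add: sum_divide_distrib)

lemma sample_mean_cos:
  fixes a :: int
  assumes M: "M > 0"
  shows "sample_mean M (\<lambda>x. cos (of_int a * x)) = (if int M dvd a then 1 else 0)"
proof -
  define z where "z = cis (2 * pi * of_int a / real M)"
  have pow: "z ^ t = cis (of_int a * sample_angle M t)" for t
    by (simp add: z_def Complex.DeMoivre sample_angle_def mult_ac)
  have "(\<Sum>t<M. cos (of_int a * sample_angle M t)) = Re (\<Sum>t<M. z ^ t)"
    by (simp add: pow)
  also have "\<dots> = (if int M dvd a then real M else 0)"
  proof (cases "int M dvd a")
    case True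
    then obtain b where "a = int M * b" by auto
    then have "z = 1"
      using M cis_multiple_2pi[of "real_of_int b"] by (simp add: z_def mult_ac)
    then show ?thesis using True by simp
  next
    case False
    have "z \<noteq> 1"
    proof
      assume "z = 1"
      then have "cos (2 * pi * of_int a / real M) = 1"
        by (simp add: z_def complex_eq_iff)
      then obtain k :: int where "2 * pi * of_int a / real M = of_int k * 2 * pi"
        using cos_one_2pi_int by auto
      then have "real_of_int a = real_of_int (k * int M)"
        using M by (simp add: field_simps)
      then have "a = k * int M" by linarith
      then show False using False by simp
    qed
    moreover have "z ^ M = 1"
      using M by (simp add: z_def Complex.DeMoivre)
    ultimately show ?thesis using False
      by (simp add: geometric_sum)
  qed
  finally show ?thesis using M by (simp add: sample_mean_def)
qed

text \<open>The recursion behind the Fourier formula: conditioning on one sign shifts the target.\<close>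
lemma prob_sum_insert:
  assumes A: "finite A" "x \<notin> A"
  shows "measure_pmf.prob (Pi_pmf (insert x A) 0 (\<lambda>_. lazy_sign_pmf \<mu>))
           {\<eta>. (\<Sum>i\<in>insert x A. \<eta> i * v i) = a} =
         (\<Sum>y\<in>{-1,0,1}. pmf (lazy_sign_pmf \<mu>) y *
           measure_pmf.prob (Pi_pmf A 0 (\<lambda>_. lazy_sign_pmf \<mu>))
             {\<eta>. (\<Sum>i\<in>A. \<eta> i * v i) = a - y * v x})"
proof -
  let ?P = "Pi_pmf A 0 (\<lambda>_. lazy_sign_pmf \<mu>)"
  have set: "set_pmf (lazy_sign_pmf \<mu>) \<subseteq> {-1,0,1}"
    by (auto simp: lazy_sign_pmf_def split: if_splits)
  have eq: "(\<Sum>i\<in>insert x A. (f(x := y)) i * v i) = y * v x + (\<Sum>i\<in>A. f i * v i)" for f y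
    using A by (simp add: sum.insert) (intro sum.cong, auto)
  let ?L = "lazy_sign_pmf \<mu>"
  have prob_eq: "measure_pmf.prob p {\<eta>. S \<eta> = a} = pmf (map_pmf S p) a"
    for p :: "('a \<Rightarrow> int) pmf" and S and a :: int
    by (simp add: pmf_map vimage_def)
  have "map_pmf (\<lambda>\<eta>. \<Sum>i\<in>insert x A. \<eta> i * v i) (Pi_pmf (insert x A) 0 (\<lambda>_. ?L)) =
        bind_pmf ?L (\<lambda>y. map_pmf (\<lambda>f. y * v x + (\<Sum>i\<in>A. f i * v i)) ?P)"
    using A by (simp add: Pi_pmf_insert' map_bind_pmf eq map_return_pmf del: fun_upd_apply sum.insert)
      (simp add: map_pmf_def)
  then have "pmf (map_pmf (\<lambda>\<eta>. \<Sum>i\<in>insert x A. \<eta> i * v i) (Pi_pmf (insert x A) 0 (\<lambda>_. ?L))) a =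
        measure_pmf.expectation ?L (\<lambda>y. pmf (map_pmf (\<lambda>f. y * v x + (\<Sum>i\<in>A. f i * v i)) ?P) a)"
    by (simp add: pmf_bind)
  also have "\<dots> = (\<Sum>y\<in>{-1,0,1}. pmf ?L y * pmf (map_pmf (\<lambda>f. y * v x + (\<Sum>i\<in>A. f i * v i)) ?P) a)"
    using set by (subst integral_measure_pmf[of "{-1,0,1}"]) auto
  also have "\<dots> = (\<Sum>y\<in>{-1,0,1}. pmf ?L y * pmf (map_pmf (\<lambda>f. \<Sum>i\<in>A. f i * v i) ?P) (a - y * v x))"
    unfolding prob_eq[symmetric] by (intro sum.cong arg_cong2[where f="(*)"] refl arg_cong[where f="measure_pmf.prob ?P"]) auto
  finally show ?thesis by (simp only: prob_eq)
qed

text \<open>Orthogonality of characters detects the event that the sum is congruent to \<open>a\<close> modulo \<open>M\<close>,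
  which contains the event that it equals \<open>a\<close>; hence an inequality for every modulus \<open>M\<close>.\<close>
lemma prob_sum_le_sample_mean:
  fixes v :: "'a \<Rightarrow> int"
  assumes A: "finite A" and \<mu>: "0 \<le> \<mu>" "\<mu> \<le> 1" and M: "M > 0"
  shows "measure_pmf.prob (Pi_pmf A 0 (\<lambda>_. lazy_sign_pmf \<mu>)) {\<eta>. (\<Sum>i\<in>A. \<eta> i * v i) = a} \<le>
         sample_mean M (\<lambda>x. cos (of_int a * x) * (\<Prod>i\<in>A. 1 - \<mu> + \<mu> * cos (of_int (v i) * x)))"
  using A
proof (induction A arbitrary: a rule: finite_induct)
  case empty
  then show ?case by (auto simp: sample_mean_cos[OF M] indicator_def)
next
  case (insert z A)
  let ?P = "\<lambda>x. \<Prod>i\<in>A. 1 - \<mu> + \<mu> * cos (of_int (v i) * x)"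
  have split: "cos (of_int a * x) * (1 - \<mu> + \<mu> * cos (of_int (v z) * x)) =
    (\<Sum>y\<in>{-1,0,1}. pmf (lazy_sign_pmf \<mu>) y * cos (of_int (a - y * v z) * x))" for x :: real
    using \<mu> by (simp add: pmf_lazy_sign ring_distribs cos_add cos_diff)
  have "measure_pmf.prob (Pi_pmf (insert z A) 0 (\<lambda>_. lazy_sign_pmf \<mu>)) {\<eta>. (\<Sum>i\<in>insert z A. \<eta> i * v i) = a}
      \<le> (\<Sum>y\<in>{-1,0,1}. pmf (lazy_sign_pmf \<mu>) y * sample_mean M (\<lambda>x. cos (of_int (a - y * v z) * x) * ?P x))"
    unfolding prob_sum_insert[OF insert.hyps] by (intro sum_mono mult_left_mono insert.IH) auto
  also have "\<dots> = sample_mean M (\<lambda>x. (\<Sum>y\<in>{-1,0,1}. pmf (lazy_sign_pmf \<mu>) y * cos (of_int (a - y * v z) * x)) * ?P x)"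
    by (simp only: sample_mean_sum sample_mean_cmult sum_distrib_right mult.assoc)
  also have "\<dots> = sample_mean M (\<lambda>x. cos (of_int a * x) * (\<Prod>i\<in>insert z A. 1 - \<mu> + \<mu> * cos (of_int (v i) * x)))"
    using insert.hyps by (simp only: split[symmetric] prod.insert[OF insert.hyps] mult.assoc)
  finally show ?case .
qed

section \<open>An explicit unimodal step distribution\<close>

text \<open>The distribution of half the sum of \<open>2 J\<close> independent signs, with an additional mass \<open>\<epsilon>\<close> at \<open>0\<close>.
  The additional mass lets its Fourier transform \<open>kernel\<close> dominate powers of characteristic
  functions also near the zeros of the cosine.\<close>
definition step_weight :: "nat \<Rightarrow> real \<Rightarrow> int \<Rightarrow> real" where
  "step_weight J \<epsilon> m =
     (if \<bar>m\<bar> \<le> int J then real ((2 * J) choose nat (int J + m)) / 4 ^ J else 0) +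
     (if m = 0 then \<epsilon> else 0)"

definition kernel :: "nat \<Rightarrow> real \<Rightarrow> real \<Rightarrow> real" where
  "kernel J \<epsilon> x = cos x ^ (2 * J) + \<epsilon>"

text \<open>The weight with which \<open>\<Sum> m\<^sub>i w\<^sub>i = a\<close> when the \<open>m\<^sub>i\<close> are independent with weights
  \<open>step_weight J \<epsilon>\<close>.\<close>
fun walk_weight :: "nat \<Rightarrow> real \<Rightarrow> int list \<Rightarrow> int \<Rightarrow> real" where
  "walk_weight J \<epsilon> [] a = (if a = 0 then 1 else 0)"
| "walk_weight J \<epsilon> (w # ws) a =
     (\<Sum>m = -int J..int J. step_weight J \<epsilon> m * walk_weight J \<epsilon> ws (a - m * w))"

text \<open>The binomial expansion of \<open>(cis x + cis (- x)) ^ (2 * J)\<close>, shifted by the phase \<open>y\<close>.\<close>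
lemma cos_power_expand:
  fixes x y :: real
  shows "cos x ^ (2 * J) * cos y =
    (\<Sum>m = -int J..int J. real ((2 * J) choose nat (int J + m)) / 4 ^ J * cos (y - 2 * of_int m * x))"
proof -
  have two_cos: "cis x + cis (-x) = of_real (2 * cos x)"
    by (simp add: complex_eq_iff)
  have "of_real ((2 * cos x) ^ (2 * J)) * cis y = (cis x + cis (-x)) ^ (2 * J) * cis y"
    by (simp add: two_cos)
  also have "\<dots> = (\<Sum>k\<le>2*J. of_nat ((2 * J) choose k) * cis x ^ k * cis (-x) ^ (2 * J - k)) * cis y"
    by (simp add: binomial_ring)
  also have "\<dots> = (\<Sum>k\<le>2*J. of_nat ((2 * J) choose k) * cis (y - 2 * of_int (int J - int k) * x))"
    unfolding sum_distrib_right
  proof (intro sum.cong refl)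
    fix k assume "k \<in> {..2 * J}"
    then have k: "k \<le> 2 * J" by simp
    have "cis x ^ k * cis (-x) ^ (2 * J - k) * cis y = cis (y - 2 * of_int (int J - int k) * x)"
      unfolding Complex.DeMoivre cis_mult using k
      by (intro arg_cong[where f=cis]) (simp add: of_nat_diff algebra_simps)
    then show "of_nat ((2 * J) choose k) * cis x ^ k * cis (-x) ^ (2 * J - k) * cis y =
        of_nat ((2 * J) choose k) * cis (y - 2 * of_int (int J - int k) * x)"
      by (simp only: mult.assoc)
  qed
  also have "\<dots> = (\<Sum>m = -int J..int J. of_nat ((2 * J) choose nat (int J + m)) * cis (y - 2 * of_int m * x))"
  proof (rule sum.reindex_bij_witness[of _ "\<lambda>m. nat (int J - m)" "\<lambda>k. int J - int k"])
    fix k assume "k \<in> {..2 * J}"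
    then have k: "k \<le> 2 * J" by simp
    then have "nat (int J + (int J - int k)) = 2 * J - k" by simp
    then show "of_nat ((2 * J) choose nat (int J + (int J - int k))) * cis (y - 2 * of_int (int J - int k) * x) =
        of_nat ((2 * J) choose k) * cis (y - 2 * of_int (int J - int k) * x)"
      using binomial_symmetric[OF k] by simp
  qed auto
  finally have "Re (of_real ((2 * cos x) ^ (2 * J)) * cis y) =
      Re (\<Sum>m = -int J..int J. of_nat ((2 * J) choose nat (int J + m)) * cis (y - 2 * of_int m * x))"
    by (rule arg_cong)
  then have real: "(2 * cos x) ^ (2 * J) * cos y =
      (\<Sum>m = -int J..int J. real ((2 * J) choose nat (int J + m)) * cos (y - 2 * of_int m * x))"
    by (simp del: of_real_power)
  have four: "(2 * cos x) ^ (2 * J) = 4 ^ J * cos x ^ (2 * J)"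
    unfolding power_mult_distrib by (simp add: power_mult)
  have "cos x ^ (2 * J) * cos y = (4 ^ J * cos x ^ (2 * J)) * cos y / 4 ^ J" by simp
  also have "\<dots> = (\<Sum>m = -int J..int J. real ((2 * J) choose nat (int J + m)) * cos (y - 2 * of_int m * x)) / 4 ^ J"
    unfolding four[symmetric] real ..
  finally show ?thesis by (simp add: sum_divide_distrib)
qed

lemma kernel_expand:
  "kernel J \<epsilon> x * cos y = (\<Sum>m = -int J..int J. step_weight J \<epsilon> m * cos (y - 2 * of_int m * x))"
proof -
  have "(\<Sum>m = -int J..int J. step_weight J \<epsilon> m * cos (y - 2 * of_int m * x)) =
      (\<Sum>m = -int J..int J. real ((2 * J) choose nat (int J + m)) / 4 ^ J * cos (y - 2 * of_int m * x)) +
      (\<Sum>m = -int J..int J. (if m = 0 then \<epsilon> * cos y else 0))"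
    unfolding sum.distrib[symmetric]
    by (intro sum.cong refl) (auto simp: step_weight_def ring_distribs abs_le_iff)
  then show ?thesis
    by (simp add: kernel_def cos_power_expand ring_distribs)
qed

lemma sum_step_weight: "(\<Sum>m = -int J..int J. step_weight J \<epsilon> m) = 1 + \<epsilon>"
  using kernel_expand[of J \<epsilon> 0 0] by (simp add: kernel_def)

lemma step_weight_nonneg: "\<epsilon> \<ge> 0 \<Longrightarrow> step_weight J \<epsilon> m \<ge> 0"
  by (simp add: step_weight_def)

lemma walk_weight_nonneg: "\<epsilon> \<ge> 0 \<Longrightarrow> walk_weight J \<epsilon> ws a \<ge> 0"
  by (induction ws arbitrary: a) (auto intro!: sum_nonneg mult_nonneg_nonneg step_weight_nonneg)

lemma step_weight_unimodal:
  assumes "\<bar>m\<bar> \<le> \<bar>m'\<bar>" "\<epsilon> \<ge> 0"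
  shows "step_weight J \<epsilon> m' \<le> step_weight J \<epsilon> m"
proof (cases "m' = 0 \<or> \<bar>m'\<bar> > int J")
  case True
  then show ?thesis using assms by (auto simp: step_weight_def)
next
  case False
  have sym: "(2 * J) choose nat (int J + k) = (2 * J) choose (J + nat \<bar>k\<bar>)" if "\<bar>k\<bar> \<le> int J" for k
  proof (cases "k \<ge> 0")
    case True
    then show ?thesis by (simp add: nat_add_distrib)
  next
    case False
    have le: "nat (int J + k) \<le> 2 * J" using that by linarith
    have "2 * J - nat (int J + k) = J + nat \<bar>k\<bar>" using that False by linarith
    then show ?thesis using binomial_symmetric[OF le] by simp
  qed
  have "(2 * J) choose (J + nat \<bar>m'\<bar>) \<le> (2 * J) choose (J + nat \<bar>m\<bar>)"
    using assms False by (intro binomial_antimono) auto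
  then have "real ((2 * J) choose nat (int J + m')) / 4 ^ J \<le> real ((2 * J) choose nat (int J + m)) / 4 ^ J"
    using assms False by (simp add: sym divide_right_mono)
  then show ?thesis
    using assms False by (auto simp: step_weight_def)
qed

text \<open>The bound for the weight that the step distribution can give to a set of \<open>q\<close>-separated integers.\<close>
definition spread :: "nat \<Rightarrow> real \<Rightarrow> nat \<Rightarrow> real" where
  "spread J \<epsilon> q = 2 * step_weight J \<epsilon> 0 + (1 + \<epsilon>) / real q"

text \<open>By unimodality the weight of a point at distance at least \<open>q\<close> from \<open>0\<close> is at most the average
  weight of the \<open>q\<close> points from it towards \<open>0\<close>. These windows are disjoint for separated points, so
  together they contribute at most a fraction \<open>1 / q\<close> of the total mass; at most two points, one on
  each side, are nearer to \<open>0\<close>.\<close>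
lemma sum_step_weight_separated:
  fixes q :: nat
  assumes A: "A \<subseteq> {-int J..int J}" and q: "q \<ge> 1" and \<epsilon>: "\<epsilon> \<ge> 0"
    and sep: "\<And>m m'. \<lbrakk>m \<in> A; m' \<in> A; m \<noteq> m'\<rbrakk> \<Longrightarrow> \<bar>m - m'\<bar> \<ge> int q"
  shows "(\<Sum>m\<in>A. step_weight J \<epsilon> m) \<le> spread J \<epsilon> q"
proof -
  let ?w = "step_weight J \<epsilon>"
  define A1 A2 B where "A1 = {m \<in> A. 0 \<le> m \<and> m < int q}" and "A2 = {m \<in> A. m < 0 \<and> - int q < m}"
    and "B = {m \<in> A. \<bar>m\<bar> \<ge> int q}"
  have fin: "finite A" using A finite_subset by blast
  have single: "(\<Sum>m\<in>D. ?w m) \<le> ?w 0" if "\<And>m m'. m \<in> D \<Longrightarrow> m' \<in> D \<Longrightarrow> m = m'" for D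
  proof (cases "D = {}")
    case True
    then show ?thesis using step_weight_nonneg[OF \<epsilon>] by simp
  next
    case False
    then obtain m where "m \<in> D" by blast
    then have "D = {m}" using that by blast
    then show ?thesis using step_weight_unimodal[of 0 m] \<epsilon> by simp
  qed
  have 1: "(\<Sum>m\<in>A1. ?w m) \<le> ?w 0"
  proof (rule single)
    fix m m' assume "m \<in> A1" "m' \<in> A1"
    then show "m = m'" using sep[of m m'] by (cases "m = m'") (auto simp: A1_def)
  qed
  have 2: "(\<Sum>m\<in>A2. ?w m) \<le> ?w 0"
  proof (rule single)
    fix m m' assume "m \<in> A2" "m' \<in> A2"
    then show "m = m'" using sep[of m m'] by (cases "m = m'") (auto simp: A2_def)
  qed
  let ?\<phi> = "\<lambda>(a, i). a - sgn a * int i"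
  have inj: "inj_on ?\<phi> (B \<times> {..<q})"
  proof (rule inj_onI, clarify)
    fix a i a' i' assume *: "a \<in> B" "i < q" "a' \<in> B" "i' < q" "a - sgn a * int i = a' - sgn a' * int i'"
    have "sgn a = sgn a'" using * by (auto simp: B_def sgn_if split: if_splits)
    moreover have "a = a'"
    proof (rule ccontr)
      assume "a \<noteq> a'"
      then have "\<bar>a - a'\<bar> \<ge> int q" using sep * by (auto simp: B_def)
      moreover have "\<bar>a - a'\<bar> < int q"
        using * \<open>sgn a = sgn a'\<close> by (auto simp: sgn_if split: if_splits)
      ultimately show False by simp
    qed
    ultimately show "a = a' \<and> i = i'" using * q by (auto simp: sgn_if B_def split: if_splits)
  qed
  have "real q * (\<Sum>m\<in>B. ?w m) = (\<Sum>a\<in>B. \<Sum>i<q. ?w a)"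
    by (simp add: sum_distrib_left)
  also have "\<dots> \<le> (\<Sum>a\<in>B. \<Sum>i<q. ?w (?\<phi> (a, i)))"
    by (intro sum_mono step_weight_unimodal \<epsilon>) (auto simp: B_def sgn_if)
  also have "\<dots> = (\<Sum>z\<in>B \<times> {..<q}. ?w (?\<phi> z))"
    by (simp add: sum.cartesian_product split_def)
  also have "\<dots> = (\<Sum>m\<in>?\<phi> ` (B \<times> {..<q}). ?w m)"
    using sum.reindex[OF inj, of ?w] by (simp add: o_def)
  also have "\<dots> \<le> (\<Sum>m = -int J..int J. ?w m)"
  proof (intro sum_mono2)
    show "?\<phi> ` (B \<times> {..<q}) \<subseteq> {- int J..int J}"
    proof (clarify)
      fix a i assume "a \<in> B" "i < q"
      then have "\<bar>a\<bar> \<ge> int q" "a \<in> {-int J..int J}" "int i < int q" using A by (auto simp: B_def)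
      then show "a - sgn a * int i \<in> {- int J..int J}" by (auto simp: sgn_if abs_if split: if_splits)
    qed
  qed (auto simp: step_weight_nonneg \<epsilon>)
  finally have 3: "(\<Sum>m\<in>B. ?w m) \<le> (1 + \<epsilon>) / real q"
    using q by (simp add: sum_step_weight field_simps)
  have "A = A1 \<union> (A2 \<union> B)" by (auto simp: A1_def A2_def B_def)
  moreover have "A1 \<inter> (A2 \<union> B) = {}" "A2 \<inter> B = {}" by (auto simp: A1_def A2_def B_def)
  ultimately have "(\<Sum>m\<in>A. ?w m) = (\<Sum>m\<in>A1. ?w m) + ((\<Sum>m\<in>A2. ?w m) + (\<Sum>m\<in>B. ?w m))"
    using fin by (metis finite_Un sum.union_disjoint)
  then show ?thesis unfolding spread_def using 1 2 3 by linarith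
qed

section \<open>Random walks with integer steps\<close>

text \<open>The kernel involves only even multiples of the frequency, so an odd modulus loses nothing, and a modulus
  beyond the range of the walk turns congruence to \<open>a\<close> into equality.\<close>
lemma sample_mean_kernel_eq_walk_weight:
  fixes ws :: "int list"
  assumes M: "odd M" "\<bar>a\<bar> + int J * (\<Sum>w\<leftarrow>ws. \<bar>w\<bar>) < int M"
  shows "sample_mean M (\<lambda>x. cos (2 * of_int a * x) * (\<Prod>w\<leftarrow>ws. kernel J \<epsilon> (of_int w * x))) =
         walk_weight J \<epsilon> ws a"
  using M(2)
proof (induction ws arbitrary: a)
  case Nil
  have "int M dvd 2 * a \<longleftrightarrow> a = 0"
  proof
    assume "int M dvd 2 * a"
    moreover have "coprime (int M) 2" using M(1) by simp
    ultimately have "int M dvd a" by (simp add: coprime_dvd_mult_right_iff)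
    then show "a = 0" using Nil zdvd_imp_le[of "int M" "\<bar>a\<bar>"] by (cases "a = 0") auto
  qed auto
  then show ?case using sample_mean_cos[of M "2 * a"] M(1) by (simp add: odd_pos)
next
  case (Cons w ws)
  let ?Q = "\<lambda>x. \<Prod>w\<leftarrow>ws. kernel J \<epsilon> (of_int w * x)"
  have "sample_mean M (\<lambda>x. cos (2 * of_int a * x) * (\<Prod>w\<leftarrow>w # ws. kernel J \<epsilon> (of_int w * x))) =
    sample_mean M (\<lambda>x. (kernel J \<epsilon> (of_int w * x) * cos (2 * of_int a * x)) * ?Q x)"
    by (simp add: mult_ac)
  also have "\<dots> = sample_mean M (\<lambda>x. \<Sum>m = -int J..int J. step_weight J \<epsilon> m *
      (cos (2 * of_int (a - m * w) * x) * ?Q x))"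
    unfolding kernel_expand sum_distrib_right
    by (intro arg_cong[where f="sample_mean M"] ext sum.cong refl) (simp add: algebra_simps)
  also have "\<dots> = (\<Sum>m = -int J..int J. step_weight J \<epsilon> m *
      sample_mean M (\<lambda>x. cos (2 * of_int (a - m * w) * x) * ?Q x))"
    by (simp only: sample_mean_sum sample_mean_cmult)
  also have "\<dots> = (\<Sum>m = -int J..int J. step_weight J \<epsilon> m * walk_weight J \<epsilon> ws (a - m * w))"
  proof (intro sum.cong arg_cong2[where f="(*)"] refl Cons.IH)
    fix m assume "m \<in> {-int J..int J}"
    then have "\<bar>m * w\<bar> \<le> int J * \<bar>w\<bar>" by (auto simp: abs_mult intro!: mult_right_mono)
    then show "\<bar>a - m * w\<bar> + int J * (\<Sum>w\<leftarrow>ws. \<bar>w\<bar>) < int M"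
      using Cons.prems by (simp add: ring_distribs)
  qed
  finally show ?case by simp
qed

definition bounded_combs :: "real \<Rightarrow> int list \<Rightarrow> int set" where
  "bounded_combs X ws = {\<Sum>i<length ws. c i * ws ! i | c. \<forall>i<length ws. \<bar>real_of_int (c i)\<bar> \<le> X}"

lemma bounded_combsI:
  "(\<And>i. i < length ws \<Longrightarrow> \<bar>real_of_int (c i)\<bar> \<le> X) \<Longrightarrow> (\<Sum>i<length ws. c i * ws ! i) \<in> bounded_combs X ws"
  unfolding bounded_combs_def by blast

lemma bounded_combsE:
  assumes "y \<in> bounded_combs X ws"
  obtains c where "\<forall>i<length ws. \<bar>real_of_int (c i)\<bar> \<le> X" "y = (\<Sum>i<length ws. c i * ws ! i)"
  using assms unfolding bounded_combs_def by blast

lemma bounded_combs_Nil [simp]: "bounded_combs X [] = {0}"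
  by (auto simp: bounded_combs_def)

lemma bounded_combs_ConsI:
  assumes "\<bar>real_of_int c\<bar> \<le> X" "y \<in> bounded_combs X ws"
  shows "c * w + y \<in> bounded_combs X (w # ws)"
proof -
  obtain e where e: "\<forall>i<length ws. \<bar>real_of_int (e i)\<bar> \<le> X" "y = (\<Sum>i<length ws. e i * ws ! i)"
    using assms(2) by (rule bounded_combsE)
  have "(\<Sum>i<length (w # ws). case_nat c e i * (w # ws) ! i) \<in> bounded_combs X (w # ws)"
    using assms(1) e(1) by (intro bounded_combsI) (auto split: nat.split)
  then show ?thesis by (simp add: sum.lessThan_Suc_shift e(2) del: sum.lessThan_Suc)
qed

lemma bounded_combs_ConsE:
  assumes "y \<in> bounded_combs X (w # ws)"
  obtains c z where "\<bar>real_of_int c\<bar> \<le> X" "z \<in> bounded_combs X ws" "y = c * w + z"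
proof -
  obtain e where e: "\<forall>i<length (w # ws). \<bar>real_of_int (e i)\<bar> \<le> X"
      "y = (\<Sum>i<length (w # ws). e i * (w # ws) ! i)"
    using assms by (rule bounded_combsE)
  have "(\<Sum>i<length ws. e (Suc i) * ws ! i) \<in> bounded_combs X ws"
    using e(1) by (intro bounded_combsI) auto
  moreover have "y = e 0 * w + (\<Sum>i<length ws. e (Suc i) * ws ! i)"
    by (simp add: e(2) sum.lessThan_Suc_shift del: sum.lessThan_Suc)
  ultimately show thesis using that[of "e 0"] e(1) by auto
qed

lemma bounded_combs_mono: "y \<in> bounded_combs X ws \<Longrightarrow> X \<le> Y \<Longrightarrow> y \<in> bounded_combs Y ws"
  unfolding bounded_combs_def by (blast intro: order_trans)

lemma bounded_combs_add:
  assumes "y \<in> bounded_combs X ws" "z \<in> bounded_combs Y ws"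
  shows "y + z \<in> bounded_combs (X + Y) ws"
proof -
  obtain c where c: "\<forall>i<length ws. \<bar>real_of_int (c i)\<bar> \<le> X" "y = (\<Sum>i<length ws. c i * ws ! i)"
    using assms(1) by (rule bounded_combsE)
  obtain e where e: "\<forall>i<length ws. \<bar>real_of_int (e i)\<bar> \<le> Y" "z = (\<Sum>i<length ws. e i * ws ! i)"
    using assms(2) by (rule bounded_combsE)
  have "(\<Sum>i<length ws. (c i + e i) * ws ! i) \<in> bounded_combs (X + Y) ws"
    using c(1) e(1) by (intro bounded_combsI) (smt (verit) of_int_add)
  then show ?thesis by (simp add: c(2) e(2) sum.distrib ring_distribs)
qed

lemma bounded_combs_scale:
  assumes "y \<in> bounded_combs X ws"
  shows "k * y \<in> bounded_combs (\<bar>real_of_int k\<bar> * X) ws"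
proof -
  obtain c where c: "\<forall>i<length ws. \<bar>real_of_int (c i)\<bar> \<le> X" "y = (\<Sum>i<length ws. c i * ws ! i)"
    using assms by (rule bounded_combsE)
  have "(\<Sum>i<length ws. (k * c i) * ws ! i) \<in> bounded_combs (\<bar>real_of_int k\<bar> * X) ws"
    using c(1) by (intro bounded_combsI) (auto simp: abs_mult intro!: mult_left_mono)
  then show ?thesis by (simp add: c(2) sum_distrib_left mult_ac)
qed

lemma walk_weight_support:
  "walk_weight J \<epsilon> ws a \<noteq> 0 \<Longrightarrow> a \<in> bounded_combs (real J) ws"
proof (induction ws arbitrary: a)
  case Nil
  then show ?case by (auto split: if_splits)
next
  case (Cons w ws)
  then obtain m where m: "m \<in> {-int J..int J}" "walk_weight J \<epsilon> ws (a - m * w) \<noteq> 0"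
    by (auto elim!: sum.not_neutral_contains_not_neutral)
  have "m * w + (a - m * w) \<in> bounded_combs (real J) (w # ws)"
    using m Cons.IH[OF m(2)] by (intro bounded_combs_ConsI) auto
  then show ?case by simp
qed

text \<open>Two multipliers of \<open>w\<close> from which the rest of the walk can reach \<open>a\<close> differ by some \<open>m\<close> for which
  \<open>m w\<close> is a difference of two end points of that rest. So the relevant multipliers are
  \<open>q\<close>-separated.\<close>
lemma walk_weight_Cons_le:
  fixes q :: nat
  assumes C: "\<And>a. walk_weight J \<epsilon> ws a \<le> C" and \<epsilon>: "\<epsilon> \<ge> 0" and q: "q \<ge> 1"
    and sep: "\<And>m::nat. \<lbrakk>1 \<le> m; m \<le> 2 * J; int m * w \<in> bounded_combs (2 * real J) ws\<rbrakk> \<Longrightarrow> q \<le> m"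
  shows "walk_weight J \<epsilon> (w # ws) a \<le> C * spread J \<epsilon> q"
proof -
  define A where "A = {m \<in> {-int J..int J}. walk_weight J \<epsilon> ws (a - m * w) \<noteq> 0}"
  have "C \<ge> 0" using C[of 0] walk_weight_nonneg[OF \<epsilon>, of J ws 0] by linarith
  have lt: "int q \<le> m' - m" if "m \<in> A" "m' \<in> A" "m < m'" for m m'
  proof -
    have "(a - m * w) + (-1) * (a - m' * w) \<in> bounded_combs (real J + \<bar>real_of_int (-1)\<bar> * real J) ws"
      using that by (intro bounded_combs_add bounded_combs_scale walk_weight_support) (auto simp: A_def)
    moreover have "(a - m * w) + (-1) * (a - m' * w) = int (nat (m' - m)) * w"
      using that by (simp add: algebra_simps)
    ultimately have "q \<le> nat (m' - m)"
      using that by (intro sep) (auto simp: A_def)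
    then show ?thesis using that by linarith
  qed
  have "walk_weight J \<epsilon> (w # ws) a = (\<Sum>m\<in>A. step_weight J \<epsilon> m * walk_weight J \<epsilon> ws (a - m * w))"
    by (auto simp: A_def intro!: sum.mono_neutral_right)
  also have "\<dots> \<le> (\<Sum>m\<in>A. step_weight J \<epsilon> m * C)"
    by (intro sum_mono mult_left_mono C step_weight_nonneg \<epsilon>)
  also have "\<dots> = C * (\<Sum>m\<in>A. step_weight J \<epsilon> m)"
    by (simp add: sum_distrib_left mult_ac)
  also have "\<dots> \<le> C * spread J \<epsilon> q"
  proof (intro mult_left_mono sum_step_weight_separated q \<epsilon> \<open>C \<ge> 0\<close>)
    fix m m' assume "m \<in> A" "m' \<in> A" "m \<noteq> m'"
    then show "int q \<le> \<bar>m - m'\<bar>" using lt[of m m'] lt[of m' m] by linarith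
  qed (auto simp: A_def)
  finally show ?thesis .
qed

section \<open>Domination of powers of characteristic functions\<close>

text \<open>Write \<open>u = cos\<^sup>2 x\<close>. The characteristic function is at most \<open>exp (- \<mu> (1 - u) / 2)\<close> in absolute
  value, so its \<open>K\<close>-th power is at most \<open>exp (- 2 J (1 - u))\<close>. This is at most \<open>u ^ J\<close> if
  \<open>u \<ge> 1 / 2\<close>, and at most \<open>\<epsilon>\<close> otherwise. Passing to the doubled frequency takes care of the
  negative values of the characteristic function for \<open>\<mu> > 1 / 2\<close>.\<close>
lemma char_fun_power_le_kernel:
  fixes \<mu> :: real
  assumes \<mu>: "0 < \<mu>" "\<mu> \<le> 1" and K: "4 * real J \<le> real K * \<mu>" and \<epsilon>: "exp (- real J) \<le> \<epsilon>"
  shows "\<bar>1 - \<mu> + \<mu> * cos x\<bar> ^ K \<le> kernel J \<epsilon> x"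
proof -
  define u where "u = (cos x)\<^sup>2"
  have u: "0 \<le> u" "u \<le> 1" by (auto simp: u_def abs_square_le_1)
  have "\<bar>1 - \<mu> + \<mu> * cos x\<bar> \<le> (1 - \<mu>) + \<mu> * \<bar>cos x\<bar>"
    using \<mu> abs_triangle_ineq[of "1 - \<mu>" "\<mu> * cos x"] by (simp add: abs_mult)
  also have "\<dots> \<le> (1 - \<mu>) + \<mu> * ((1 + u) / 2)"
  proof -
    have "0 \<le> (1 - \<bar>cos x\<bar>)\<^sup>2" by simp
    then have "\<bar>cos x\<bar> \<le> (1 + u) / 2" by (simp add: power2_diff u_def)
    then show ?thesis using \<mu> by (intro add_left_mono mult_left_mono) auto
  qed
  also have "\<dots> = 1 + (- (\<mu> / 2 * (1 - u)))" by (simp add: field_simps)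
  also have "\<dots> \<le> exp (- (\<mu> / 2 * (1 - u)))" by (rule exp_ge_add_one_self)
  finally have "\<bar>1 - \<mu> + \<mu> * cos x\<bar> ^ K \<le> exp (- (\<mu> / 2 * (1 - u))) ^ K"
    by (intro power_mono) auto
  also have "\<dots> = exp (- (real K * \<mu> * ((1 - u) / 2)))"
    by (simp add: exp_of_nat_mult[symmetric])
  also have "\<dots> \<le> exp (- (4 * real J * ((1 - u) / 2)))"
    using mult_right_mono[OF K, of "(1 - u) / 2"] u by simp
  also have "4 * real J * ((1 - u) / 2) = 2 * real J * (1 - u)" by simp
  finally have le: "\<bar>1 - \<mu> + \<mu> * cos x\<bar> ^ K \<le> exp (- (2 * real J * (1 - u)))" .
  show ?thesis
  proof (cases "u \<ge> 1 / 2")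
    case True
    have "- (2 * (1 - u)) \<le> - (1 - u) - 2 * (1 - u)\<^sup>2"
    proof -
      have "0 \<le> (1 - u) * (2 * u - 1)" using True u by simp
      then show ?thesis by (simp add: power2_eq_square algebra_simps)
    qed
    also have "\<dots> \<le> ln u" using ln_one_minus_pos_lower_bound[of "1 - u"] True u by simp
    finally have "exp (- (2 * (1 - u))) \<le> u" using True by (simp add: ln_ge_iff)
    then have "exp (- (2 * (1 - u))) ^ J \<le> u ^ J" by (intro power_mono) auto
    moreover have "exp (- (2 * (1 - u))) ^ J = exp (- (2 * real J * (1 - u)))"
      by (simp add: exp_of_nat_mult[symmetric] algebra_simps)
    ultimately have "exp (- (2 * real J * (1 - u))) \<le> u ^ J" by simp
    moreover have "u ^ J = cos x ^ (2 * J)" by (simp add: u_def power_mult)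
    moreover have "\<epsilon> \<ge> 0" using \<epsilon> exp_ge_zero[of "- real J"] by linarith
    ultimately show ?thesis using le by (simp add: kernel_def)
  next
    case False
    have "real J * 1 \<le> real J * (2 * (1 - u))" using False by (intro mult_left_mono) auto
    then have "exp (- (2 * real J * (1 - u))) \<le> exp (- real J)" by (simp add: mult_ac)
    moreover have "cos x ^ (2 * J) \<ge> 0" by simp
    ultimately show ?thesis unfolding kernel_def using le \<epsilon> by linarith
  qed
qed

lemma central_binomial_square_le: "real ((2 * J) choose J) ^ 2 * (2 * real J + 1) \<le> 16 ^ J"
proof (induction J)
  case (Suc J)
  let ?c = "real ((2 * J) choose J)"
  have "Suc J * ((2 * Suc J) choose Suc J) = 2 * (2 * J + 1) * ((2 * J) choose J)"
  proof -
    have 1: "Suc J * (Suc (Suc (2 * J)) choose Suc J) = Suc (Suc (2 * J)) * (Suc (2 * J) choose J)"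
      by (rule Suc_times_binomial)
    have "Suc (2 * J) choose J = Suc (2 * J) choose Suc J"
      using binomial_symmetric[of J "Suc (2 * J)"] by simp
    moreover have "Suc J * (Suc (2 * J) choose Suc J) = Suc (2 * J) * ((2 * J) choose J)"
      by (rule Suc_times_binomial)
    ultimately have 2: "Suc J * (Suc (2 * J) choose J) = Suc (2 * J) * ((2 * J) choose J)" by simp
    have "Suc J * (Suc J * (Suc (Suc (2 * J)) choose Suc J)) = Suc (Suc (2 * J)) * (Suc J * (Suc (2 * J) choose J))"
      unfolding 1 by (simp only: mult.left_commute)
    also have "\<dots> = Suc J * (2 * (2 * J + 1) * ((2 * J) choose J))"
      unfolding 2 by (simp add: algebra_simps)
    finally have "Suc J * (Suc (Suc (2 * J)) choose Suc J) = 2 * (2 * J + 1) * ((2 * J) choose J)"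
      by (simp only: nat_mult_eq_cancel1 zero_less_Suc)
    moreover have "2 * Suc J = Suc (Suc (2 * J))" by simp
    ultimately show ?thesis by (simp only:)
  qed
  then have "real (Suc J * ((2 * Suc J) choose Suc J)) = real (2 * (2 * J + 1) * ((2 * J) choose J))"
    by (rule arg_cong)
  then have eq: "real ((2 * Suc J) choose Suc J) = 2 * (2 * real J + 1) * ?c / (real J + 1)"
    by (simp add: field_simps)
  have "real ((2 * Suc J) choose Suc J) ^ 2 * (2 * real (Suc J) + 1) =
      (?c ^ 2 * (2 * real J + 1)) * (4 * ((2 * real J + 1) * (2 * real J + 3)) / (real J + 1) ^ 2)"
    unfolding eq by (simp add: power2_eq_square field_simps)
  also have "\<dots> \<le> 16 ^ J * 16"
  proof (intro mult_mono Suc.IH)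
    have "(2 * real J + 1) * (2 * real J + 3) \<le> 4 * (real J + 1) ^ 2"
      by (simp add: power2_eq_square algebra_simps)
    then show "4 * ((2 * real J + 1) * (2 * real J + 3)) / (real J + 1) ^ 2 \<le> 16"
      by (subst pos_divide_le_eq) auto
  qed auto
  finally show ?case by simp
qed auto

lemma step_weight_0_le:
  assumes "J \<ge> 1"
  shows "step_weight J \<epsilon> 0 \<le> 1 / sqrt (real J) + \<epsilon>"
proof -
  let ?c = "real ((2 * J) choose J)"
  have "?c ^ 2 * real J \<le> ?c ^ 2 * (2 * real J + 1)" by (intro mult_left_mono) auto
  also have "\<dots> \<le> 16 ^ J" by (rule central_binomial_square_le)
  finally have "sqrt (?c ^ 2 * real J) \<le> sqrt ((4 ^ J) ^ 2)"
    by (simp add: power_mult[symmetric] mult.commute[of J 2]) (simp add: power_mult)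
  then have "?c * sqrt (real J) \<le> 4 ^ J" by (simp add: real_sqrt_mult)
  then have "?c / 4 ^ J \<le> 1 / sqrt (real J)" using assms by (simp add: field_simps)
  then show ?thesis by (simp add: step_weight_def)
qed

lemma prod_le_mean_power:
  fixes f :: "'a \<Rightarrow> real"
  assumes "finite B" "card B = K" "K \<ge> 1" "\<And>i. i \<in> B \<Longrightarrow> f i \<ge> 0"
  shows "(\<Prod>i\<in>B. f i) \<le> (\<Sum>i\<in>B. f i ^ K) / real K"
proof -
  have ne: "B \<noteq> {}" using assms by auto
  have "(\<Prod>i\<in>B. f i) = root K ((\<Prod>i\<in>B. f i) ^ K)"
    using assms by (simp add: real_root_power_cancel prod_nonneg)
  also have "\<dots> = root K (\<Prod>i\<in>B. f i ^ K)" by (simp add: prod_power_distrib)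
  also have "\<dots> = (\<Prod>i\<in>B. f i ^ K) powr (1 / real K)"
    using assms by (intro root_powr_inverse) (auto intro!: prod_nonneg)
  also have "\<dots> \<le> (\<Sum>i\<in>B. f i ^ K / real K)"
    using arith_geom_mean[of B "\<lambda>i. f i ^ K"] assms ne by auto
  also have "\<dots> = (\<Sum>i\<in>B. f i ^ K) / real K" by (simp add: sum_divide_distrib)
  finally show ?thesis .
qed

section \<open>Dissociated families\<close>

definition dissociated :: "real \<Rightarrow> int list \<Rightarrow> bool" where
  "dissociated X ws \<longleftrightarrow> (\<forall>c. (\<forall>i<length ws. \<bar>real_of_int (c i)\<bar> \<le> X) \<longrightarrow>
      (\<Sum>i<length ws. c i * ws ! i) = 0 \<longrightarrow> (\<forall>i<length ws. c i = 0))"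

lemma dissociatedD:
  assumes "dissociated X ws" "\<And>i. i < length ws \<Longrightarrow> \<bar>real_of_int (c i)\<bar> \<le> X"
    "(\<Sum>i<length ws. c i * ws ! i) = 0" "i < length ws"
  shows "c i = 0"
  using assms unfolding dissociated_def by blast

lemma dissociated_Nil [simp]: "dissociated X []"
  by (simp add: dissociated_def)

lemma dissociated_tl:
  assumes "dissociated X (w # ws)" "X \<ge> 0"
  shows "dissociated X ws"
  unfolding dissociated_def
proof (intro allI impI)
  fix c i assume c: "\<forall>i<length ws. \<bar>real_of_int (c i)\<bar> \<le> X" "(\<Sum>i<length ws. c i * ws ! i) = 0" "i < length ws"
  have "(case_nat 0 c) (Suc i) = 0"
    using assms c
    by (intro dissociatedD[OF assms(1), of "case_nat 0 c"])
       (auto split: nat.split simp: sum.lessThan_Suc_shift simp del: sum.lessThan_Suc)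
  then show "c i = 0" by simp
qed

lemma dissociated_multiple_notin:
  assumes "dissociated X (w # ws)" "1 \<le> m" "real m \<le> X"
  shows "int m * w \<notin> bounded_combs X ws"
proof
  assume "int m * w \<in> bounded_combs X ws"
  then obtain c where c: "\<forall>i<length ws. \<bar>real_of_int (c i)\<bar> \<le> X" "int m * w = (\<Sum>i<length ws. c i * ws ! i)"
    by (rule bounded_combsE)
  have "(case_nat (int m) (\<lambda>i. - c i)) 0 = 0"
    using assms c
    by (intro dissociatedD[OF assms(1), of "case_nat (int m) (\<lambda>i. - c i)"])
       (auto split: nat.split simp: sum.lessThan_Suc_shift sum_negf simp del: sum.lessThan_Suc)
  then show False using assms by simp
qed

lemma not_dissociated_Cons:
  assumes "dissociated Y ws" "X \<le> Y" "\<not> dissociated X (w # ws)"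
  obtains D :: nat where "1 \<le> D" "real D \<le> X" "int D * w \<in> bounded_combs X ws"
proof -
  obtain c j where c: "\<forall>i<length (w # ws). \<bar>real_of_int (c i)\<bar> \<le> X"
      "(\<Sum>i<length (w # ws). c i * (w # ws) ! i) = 0" "j < length (w # ws)" "c j \<noteq> 0"
    using assms(3) unfolding dissociated_def by blast
  have sum0: "c 0 * w + (\<Sum>i<length ws. c (Suc i) * ws ! i) = 0"
    using c(2) by (simp add: sum.lessThan_Suc_shift del: sum.lessThan_Suc)
  have c0: "c 0 \<noteq> 0"
  proof
    assume "c 0 = 0"
    then have "c (Suc i) = 0" if "i < length ws" for i
      using sum0 c(1) assms(2) that
      by (intro dissociatedD[OF assms(1), of "\<lambda>i. c (Suc i)"]) (auto intro: order_trans)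
    then show False using \<open>c 0 = 0\<close> c(3,4) by (cases j) auto
  qed
  define D where "D = nat \<bar>c 0\<bar>"
  have "int D * w = (\<Sum>i<length ws. (- sgn (c 0) * c (Suc i)) * ws ! i)"
  proof -
    have "int D = sgn (c 0) * c 0" by (simp add: D_def sgn_if)
    moreover have "c 0 * w = - (\<Sum>i<length ws. c (Suc i) * ws ! i)" using sum0 by linarith
    ultimately show ?thesis by (simp add: sum_distrib_left sum_negf mult.assoc)
  qed
  also have "\<dots> \<in> bounded_combs X ws"
    using c(1) c0 by (intro bounded_combsI) (auto simp: abs_mult sgn_if)
  finally show thesis using that[of D] c0 c(1) by (auto simp: D_def)
qed

text \<open>In a dissociated family no multiplier up to \<open>2 J\<close> brings an element into the combinations of the
  later ones in the list, so every step is separated by \<open>2 J + 1\<close>.\<close>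
lemma walk_weight_dissociated_le:
  assumes "dissociated X ws" "2 * real J \<le> X" "\<epsilon> \<ge> 0"
  shows "walk_weight J \<epsilon> ws a \<le> spread J \<epsilon> (2 * J + 1) ^ length ws"
  using assms(1)
proof (induction ws arbitrary: a)
  case (Cons w ws)
  have X0: "X \<ge> 0" using assms(2) by linarith
  have "walk_weight J \<epsilon> (w # ws) a \<le> spread J \<epsilon> (2 * J + 1) ^ length ws *
     spread J \<epsilon> (2 * J + 1)"
  proof (rule walk_weight_Cons_le)
    show "walk_weight J \<epsilon> ws a \<le> spread J \<epsilon> (2 * J + 1) ^ length ws" for a
      by (rule Cons.IH[OF dissociated_tl[OF Cons.prems X0]])
    fix m :: nat assume m: "1 \<le> m" "m \<le> 2 * J" "int m * w \<in> bounded_combs (2 * real J) ws"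
    have "int m * w \<in> bounded_combs X ws" by (rule bounded_combs_mono[OF m(3) assms(2)])
    moreover have "real m \<le> X"
      using of_nat_mono[OF m(2), where 'a = real] assms(2) by simp
    ultimately show "2 * J + 1 \<le> m" using dissociated_multiple_notin[OF Cons.prems m(1)] by simp
  qed (use assms in auto)
  then show ?case by (simp add: mult.commute)
qed auto

text \<open>Elements \<open>u\<close> with common denominator \<open>s\<close> over \<open>bs\<close> can be eliminated from a combination after
  multiplying by \<open>s\<close>, at the price of a controlled growth of the coefficients.\<close>
lemma bounded_combs_append_scaled:
  fixes s :: nat
  assumes us: "\<And>u. u \<in> set us \<Longrightarrow> int s * u \<in> bounded_combs (real s * N) bs"
    and y: "y \<in> bounded_combs X (us @ bs)" and X: "X \<ge> 0" and N: "N \<ge> 0"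
  shows "int s * y \<in> bounded_combs (X * (real s * (real (length us) * N + 1))) bs"
  using us y
proof (induction us arbitrary: y)
  case Nil
  then show ?case using bounded_combs_scale[of y X bs "int s"] by (simp add: mult.commute)
next
  case (Cons u us)
  from Cons.prems(2) obtain c z where c: "\<bar>real_of_int c\<bar> \<le> X" "z \<in> bounded_combs X (us @ bs)" "y = c * u + z"
    by (auto elim: bounded_combs_ConsE)
  have "c * (int s * u) + int s * z \<in>
      bounded_combs (\<bar>real_of_int c\<bar> * (real s * N) + X * (real s * (real (length us) * N + 1))) bs"
    using Cons.prems c by (intro bounded_combs_add bounded_combs_scale Cons.IH) auto
  moreover have "c * (int s * u) + int s * z = int s * y" by (simp add: c(3) algebra_simps)
  moreover have "\<bar>real_of_int c\<bar> * (real s * N) \<le> X * (real s * N)"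
    using c(1) N by (intro mult_right_mono) auto
  moreover have "X * (real s * N) + X * (real s * (real (length us) * N + 1)) =
      X * (real s * (real (length (u # us)) * N + 1))" by (simp add: algebra_simps)
  ultimately show ?case
    by (smt (verit) bounded_combs_mono)
qed

text \<open>Dissociativity makes the coordinates of \<open>u\<close> with respect to \<open>bs\<close> unique. So whenever \<open>k u\<close> has
  integer coordinates of moderate size \<open>Z\<close>, they are \<open>k\<close> times the rational coordinates of \<open>u\<close>,
  and inherit the much better bound that the latter satisfy.\<close>
lemma dissociated_multiple_coeff_bound:
  fixes D k :: nat
  assumes dis: "dissociated Y bs" and D: "1 \<le> D" "int D * u \<in> bounded_combs N bs"
    and k: "int k * u \<in> bounded_combs Z bs" and Y: "real D * Z + real k * N \<le> Y"
  shows "int k * u \<in> bounded_combs (real k * N) bs"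
proof -
  obtain a where a: "\<forall>i<length bs. \<bar>real_of_int (a i)\<bar> \<le> N" "int D * u = (\<Sum>i<length bs. a i * bs ! i)"
    using D(2) by (rule bounded_combsE)
  obtain e where e: "\<forall>i<length bs. \<bar>real_of_int (e i)\<bar> \<le> Z" "int k * u = (\<Sum>i<length bs. e i * bs ! i)"
    using k by (rule bounded_combsE)
  have eq: "int D * e i = int k * a i" if i: "i < length bs" for i
  proof -
    have "(\<Sum>i<length bs. (int D * e i - int k * a i) * bs ! i) = int D * (int k * u) - int k * (int D * u)"
      unfolding a(2) e(2) by (simp add: sum_distrib_left sum_subtractf left_diff_distrib mult.assoc)
    then have 0: "(\<Sum>i<length bs. (int D * e i - int k * a i) * bs ! i) = 0" by simp
    have "int D * e i - int k * a i = 0"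
    proof (rule dissociatedD[OF dis _ 0 i])
      fix j assume j: "j < length bs"
      have "\<bar>real_of_int (int D * e j - int k * a j)\<bar> \<le> \<bar>real D * real_of_int (e j)\<bar> + \<bar>real k * real_of_int (a j)\<bar>"
        using abs_triangle_ineq4[of "real D * real_of_int (e j)" "real k * real_of_int (a j)"] by simp
      also have "\<dots> \<le> real D * Z + real k * N"
        using a(1) e(1) j by (intro add_mono) (auto simp: abs_mult intro!: mult_left_mono)
      finally show "\<bar>real_of_int (int D * e j - int k * a j)\<bar> \<le> Y" using Y by linarith
    qed
    then show ?thesis by simp
  qed
  show ?thesis unfolding e(2)
  proof (rule bounded_combsI)
    fix i assume i: "i < length bs"
    have "1 * \<bar>real_of_int (e i)\<bar> \<le> real D * \<bar>real_of_int (e i)\<bar>"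
      using D(1) by (intro mult_right_mono) auto
    also have "\<dots> = real k * \<bar>real_of_int (a i)\<bar>"
      using arg_cong[OF eq[OF i], of "\<lambda>z. \<bar>real_of_int z\<bar>"] by (simp add: abs_mult)
    also have "\<dots> \<le> real k * N" using a(1) i by (intro mult_left_mono) auto
    finally show "\<bar>real_of_int (e i)\<bar> \<le> real k * N" by simp
  qed
qed

section \<open>Replacing blocks by powers of one element\<close>

locale concentrated_sum =
  fixes n :: nat and v :: "nat \<Rightarrow> int" and \<mu> \<epsilon> \<delta> :: real and J K M :: nat
  assumes mu_pos: "0 < \<mu>" and mu_le: "\<mu> \<le> 1"
    and K_pos: "K \<ge> 1" and K_large: "4 * real J \<le> real K * \<mu>"
    and eps: "exp (- real J) \<le> \<epsilon>"
    and M_odd: "odd M" and M_large: "int J * (int n * (\<Sum>i=1..n. \<bar>v i\<bar>)) < int M"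
    and conc: "\<delta> \<le> conc_prob \<mu> n v"
begin

lemma eps_nonneg: "\<epsilon> \<ge> 0"
  using eps exp_ge_zero[of "- real J"] by linarith

definition char_abs :: "nat \<Rightarrow> real \<Rightarrow> real" where
  "char_abs i x = \<bar>1 - \<mu> + \<mu> * cos (of_int (v i) * x)\<bar>"

definition mixed_mean :: "nat set \<Rightarrow> int list \<Rightarrow> real" where
  "mixed_mean I ws =
     sample_mean M (\<lambda>x. (\<Prod>i\<in>I. char_abs i x) * (\<Prod>w\<leftarrow>ws. kernel J \<epsilon> (of_int w * x)))"

lemma char_abs_nonneg: "char_abs i x \<ge> 0"
  by (simp add: char_abs_def)

lemma char_abs_le_1: "char_abs i x \<le> 1"
proof -
  let ?c = "cos (of_int (v i) * x)"
  have "\<mu> * ?c \<le> \<mu> * 1" "\<mu> * (-1) \<le> \<mu> * ?c"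
    using mu_pos by (intro mult_left_mono; simp)+
  then show ?thesis using mu_le by (simp add: char_abs_def abs_le_iff)
qed

lemma kernel_nonneg: "kernel J \<epsilon> x \<ge> 0"
  using eps_nonneg by (simp add: kernel_def)

lemma kernels_nonneg: "(\<Prod>w\<leftarrow>ws. kernel J \<epsilon> (of_int w * x)) \<ge> 0"
  by (induction ws) (auto simp: kernel_nonneg)

text \<open>The states of the selection process: \<open>ws\<close> lists the selected elements and \<open>I\<close> the indices not used
  up, each selection consuming exactly \<open>K\<close> indices.\<close>
definition replaced :: "nat set \<Rightarrow> int list \<Rightarrow> bool" where
  "replaced I ws \<longleftrightarrow> I \<subseteq> {1..n} \<and> set ws \<subseteq> v ` {1..n} \<and> card I + K * length ws = n \<and>
     \<delta> \<le> mixed_mean I ws"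

lemma replaced_initial: "replaced {1..n} []"
proof -
  have M: "M > 0" using M_odd by (simp add: odd_pos)
  have "conc_prob \<mu> n v \<le> mixed_mean {1..n} []"
    unfolding conc_prob_def
  proof (subst Max_le_iff[OF finite_conc_prob_range], simp, safe)
    fix a :: int
    have "measure_pmf.prob (Pi_pmf {1..n} 0 (\<lambda>_. lazy_sign_pmf \<mu>)) {\<eta>. (\<Sum>i=1..n. \<eta> i * v i) = a}
      \<le> sample_mean M (\<lambda>x. cos (of_int a * x) * (\<Prod>i=1..n. 1 - \<mu> + \<mu> * cos (of_int (v i) * x)))"
      using mu_pos mu_le M by (intro prob_sum_le_sample_mean) auto
    also have "\<dots> \<le> mixed_mean {1..n} []"
      unfolding mixed_mean_def
    proof (rule sample_mean_mono)
      fix x :: real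
      let ?p = "\<Prod>i=1..n. 1 - \<mu> + \<mu> * cos (of_int (v i) * x)"
      have "cos (of_int a * x) * ?p \<le> \<bar>cos (of_int a * x)\<bar> * \<bar>?p\<bar>"
        by (simp add: abs_mult[symmetric])
      also have "\<dots> \<le> 1 * \<bar>?p\<bar>" by (intro mult_right_mono) auto
      also have "\<bar>?p\<bar> = (\<Prod>i=1..n. char_abs i x)" by (simp add: abs_prod char_abs_def)
      finally show "cos (of_int a * x) * ?p \<le>
          (\<Prod>i=1..n. char_abs i x) * (\<Prod>w\<leftarrow>[]. kernel J \<epsilon> (of_int w * x))" by simp
    qed
    finally show "measure_pmf.prob (Pi_pmf {1..n} 0 (\<lambda>_. lazy_sign_pmf \<mu>))
        {\<eta>. (\<Sum>i=1..n. \<eta> i * v i) = a} \<le> mixed_mean {1..n} []" .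
  qed
  then show ?thesis using conc by (simp add: replaced_def)
qed

text \<open>The product over the block \<open>B\<close> is at most the mean of the \<open>K\<close>-th powers of its factors. All the other
  factors are nonnegative, so some power does at least as well as the mean.\<close>
lemma mixed_mean_exchange:
  assumes I: "finite I" "B \<subseteq> I" "card B = K"
  shows "\<exists>b\<in>B. mixed_mean I ws \<le> mixed_mean (I - B) (v b # ws)"
proof (rule ccontr)
  assume "\<not> ?thesis"
  then have less: "mixed_mean (I - B) (v b # ws) < mixed_mean I ws" if "b \<in> B" for b
    using that by force
  have B: "finite B" "B \<noteq> {}" using I K_pos finite_subset by fastforce+
  let ?R = "\<lambda>x. (\<Prod>i\<in>I - B. char_abs i x) * (\<Prod>w\<leftarrow>ws. kernel J \<epsilon> (of_int w * x))"
  have R0: "?R x \<ge> 0" for x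
    by (intro mult_nonneg_nonneg prod_nonneg kernels_nonneg) (auto simp: char_abs_nonneg)
  have "mixed_mean I ws = sample_mean M (\<lambda>x. (\<Prod>i\<in>B. char_abs i x) * ?R x)"
    unfolding mixed_mean_def prod.subset_diff[OF I(2,1)] by (simp only: mult_ac)
  also have "\<dots> \<le> sample_mean M (\<lambda>x. \<Sum>b\<in>B. 1 / real K * (kernel J \<epsilon> (of_int (v b) * x) * ?R x))"
  proof (rule sample_mean_mono)
    fix x
    have "(\<Prod>i\<in>B. char_abs i x) \<le> (\<Sum>b\<in>B. char_abs b x ^ K) / real K"
      using B I K_pos by (intro prod_le_mean_power) (auto simp: char_abs_nonneg)
    also have "\<dots> \<le> (\<Sum>b\<in>B. kernel J \<epsilon> (of_int (v b) * x)) / real K"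
      unfolding char_abs_def
      by (intro divide_right_mono sum_mono char_fun_power_le_kernel mu_pos mu_le K_large eps) auto
    finally have "(\<Prod>i\<in>B. char_abs i x) * ?R x \<le> (\<Sum>b\<in>B. kernel J \<epsilon> (of_int (v b) * x)) / real K * ?R x"
      by (intro mult_right_mono R0)
    then show "(\<Prod>i\<in>B. char_abs i x) * ?R x \<le>
        (\<Sum>b\<in>B. 1 / real K * (kernel J \<epsilon> (of_int (v b) * x) * ?R x))"
      by (simp only: sum_divide_distrib sum_distrib_right times_divide_eq_left mult_1)
  qed
  also have "\<dots> = (\<Sum>b\<in>B. 1 / real K * mixed_mean (I - B) (v b # ws))"
    unfolding sample_mean_sum sample_mean_cmult mixed_mean_def by (simp add: mult_ac)
  also have "\<dots> < (\<Sum>b\<in>B. 1 / real K * mixed_mean I ws)"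
    using B K_pos less by (intro sum_strict_mono) (auto intro!: divide_strict_right_mono)
  also have "\<dots> = mixed_mean I ws" using I K_pos by simp
  finally show False by simp
qed

lemma replaced_extend:
  assumes I: "replaced I ws" and B: "B \<subseteq> I" "card B \<ge> K"
  obtains b I' where "b \<in> B" "I' \<subseteq> I" "replaced I' (v b # ws)"
proof -
  have fin: "finite I" using I finite_subset unfolding replaced_def by blast
  obtain B' where B': "B' \<subseteq> B" "card B' = K" using B(2) by (meson obtain_subset_with_card_n)
  obtain b where b: "b \<in> B'" "mixed_mean I ws \<le> mixed_mean (I - B') (v b # ws)"
    using mixed_mean_exchange[OF fin _ B'(2), of ws] B B' by blast
  have "card (I - B') = card I - K"
    using B B' fin by (subst card_Diff_subset) (auto intro: finite_subset)
  moreover have "card I \<ge> K" using card_mono[OF fin, of B'] B B' by auto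
  ultimately have "replaced (I - B') (v b # ws)"
    using I b B B' unfolding replaced_def by auto
  then show thesis using that[of b "I - B'"] b B' by auto
qed

lemma replaced_length: "replaced I ws \<Longrightarrow> length ws \<le> n"
proof -
  assume "replaced I ws"
  then have "K * length ws \<le> n" by (simp add: replaced_def)
  moreover have "1 * length ws \<le> K * length ws" by (rule mult_le_mono1[OF K_pos])
  ultimately show ?thesis by linarith
qed

text \<open>The factors of the unused indices are at most \<open>1\<close>, and what is left after dropping them is the
  Fourier formula for the walk.\<close>
lemma replaced_walk_weight:
  assumes "replaced I ws"
  shows "\<delta> \<le> walk_weight J \<epsilon> ws 0"
proof -
  let ?V = "\<Sum>i=1..n. \<bar>v i\<bar>"
  have le: "(\<Sum>w\<leftarrow>us. \<bar>w\<bar>) \<le> int (length us) * ?V" if "set us \<subseteq> v ` {1..n}" for us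
    using that
  proof (induction us)
    case (Cons u us)
    then obtain i where "i \<in> {1..n}" "u = v i" by auto
    then have "\<bar>u\<bar> \<le> ?V" using member_le_sum[of i "{1..n}" "\<lambda>i. \<bar>v i\<bar>"] by auto
    then show ?case using Cons by (simp add: ring_distribs)
  qed auto
  have "(\<Sum>w\<leftarrow>ws. \<bar>w\<bar>) \<le> int (length ws) * ?V" using assms by (intro le) (simp add: replaced_def)
  also have "\<dots> \<le> int n * ?V"
    using replaced_length[OF assms] by (intro mult_right_mono sum_nonneg) auto
  finally have "int J * (\<Sum>w\<leftarrow>ws. \<bar>w\<bar>) \<le> int J * (int n * ?V)" by (intro mult_left_mono) auto
  then have M: "\<bar>0\<bar> + int J * (\<Sum>w\<leftarrow>ws. \<bar>w\<bar>) < int M" using M_large by simp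
  have "\<delta> \<le> mixed_mean I ws" using assms by (simp add: replaced_def)
  also have "\<dots> \<le> sample_mean M (\<lambda>x. cos (2 * of_int 0 * x) * (\<Prod>w\<leftarrow>ws. kernel J \<epsilon> (of_int w * x)))"
    unfolding mixed_mean_def
    by (intro sample_mean_mono mult_right_mono kernels_nonneg)
       (auto intro!: prod_le_1 simp: char_abs_nonneg char_abs_le_1)
  also have "\<dots> = walk_weight J \<epsilon> ws 0"
    by (rule sample_mean_kernel_eq_walk_weight[OF M_odd M])
  finally show ?thesis .
qed

section \<open>The two rounds of selection\<close>

text \<open>A selection of maximal length \<open>r\<close> among those dissociated at scale \<open>X r\<close>. The length \<open>d\<close> is impossible
  because the walk would return to \<open>0\<close> with weight less than \<open>\<delta>\<close>. If \<open>K\<close> of the remaining elements had no short relation to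
  the selection, one of them could be added.\<close>
lemma exists_maximal_dissociated:
  fixes X :: "nat \<Rightarrow> real" and d :: nat
  assumes anti: "\<And>r. r < d \<Longrightarrow> X (Suc r) \<le> X r" and large: "2 * real J \<le> X d"
    and d: "spread J \<epsilon> (2 * J + 1) ^ d < \<delta>"
  obtains I bs where "length bs < d" "replaced I bs" "dissociated (X (length bs)) bs"
    "card {i \<in> I. \<not> (\<exists>D::nat. 1 \<le> D \<and> real D \<le> X (Suc (length bs)) \<and>
        int D * v i \<in> bounded_combs (X (Suc (length bs))) bs)} < K"
proof -
  define P where "P r \<longleftrightarrow> r \<le> d \<and> (\<exists>I bs. length bs = r \<and> replaced I bs \<and> dissociated (X r) bs)" for r
  have "P 0" unfolding P_def using replaced_initial by (intro conjI exI[of _ "{1..n}"] exI[of _ "[]"]) auto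
  define r where "r = (GREATEST r. P r)"
  have r: "P r" and max: "\<And>r'. P r' \<Longrightarrow> r' \<le> r"
    unfolding r_def using GreatestI_nat[of P 0 d, OF \<open>P 0\<close>] Greatest_le_nat[of P _ d] by (auto simp: P_def)
  obtain I bs where bs: "length bs = r" "replaced I bs" "dissociated (X r) bs"
    using r by (auto simp: P_def)
  have "r \<noteq> d"
  proof
    assume "r = d"
    then have "walk_weight J \<epsilon> bs 0 \<le> spread J \<epsilon> (2 * J + 1) ^ d"
      using walk_weight_dissociated_le[OF bs(3) _ eps_nonneg] large bs(1) by simp
    then show False using replaced_walk_weight[OF bs(2)] d by simp
  qed
  then have rd: "r < d" using r by (simp add: P_def)
  define B where "B = {i \<in> I. \<not> (\<exists>D::nat. 1 \<le> D \<and> real D \<le> X (Suc r) \<and>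
      int D * v i \<in> bounded_combs (X (Suc r)) bs)}"
  have "card B < K"
  proof (rule ccontr)
    assume "\<not> card B < K"
    then have "B \<subseteq> I" "K \<le> card B" by (auto simp: B_def)
    then obtain b I' where b: "b \<in> B" "replaced I' (v b # bs)"
      by (rule replaced_extend[OF bs(2)])
    have "dissociated (X (Suc r)) (v b # bs)"
    proof (rule ccontr)
      assume "\<not> dissociated (X (Suc r)) (v b # bs)"
      then obtain D :: nat where "1 \<le> D" "real D \<le> X (Suc r)" "int D * v b \<in> bounded_combs (X (Suc r)) bs"
        by (rule not_dissociated_Cons[OF bs(3) anti[OF rd]])
      then show False using b(1) by (auto simp: B_def)
    qed
    then have "P (Suc r)" unfolding P_def using b(2) bs(1) rd
      by (intro conjI exI[of _ I'] exI[of _ "v b # bs"]) auto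
    then have "Suc r \<le> r" by (rule max)
    then show False by simp
  qed
  then show thesis using that[of bs I] bs rd by (simp add: B_def)
qed

text \<open>A second selection of maximal length \<open>t\<close>, now of elements that have rational coordinates over \<open>bs\<close>,
  together with a common denominator \<open>s\<close> of them. An element whose denominator does not divide \<open>s\<close>
  multiplies \<open>s\<close> by some \<open>q \<ge> 2\<close> and the weight of the walk by at most \<open>q powr (- c)\<close>. So \<open>s powr (- c)\<close>
  bounds the weight throughout, and the assumption on \<open>S\<close> turns this into \<open>s \<le> S\<close>. The scale \<open>Y\<close>
  has to exceed the coefficients of all relations compared on the way.\<close>
lemma exists_common_denominator:
  fixes c N S Y :: real
  assumes I0: "replaced I0 bs" and dis: "dissociated Y bs" and one: "\<And>a. walk_weight J \<epsilon> bs a \<le> 1"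
    and few: "card {i \<in> I0. \<not> (\<exists>D::nat. 1 \<le> D \<and> real D \<le> N \<and> int D * v i \<in> bounded_combs N bs)} < K"
    and N: "N \<ge> 1"
    and gain: "\<And>q::nat. 2 \<le> q \<Longrightarrow> real q \<le> N \<Longrightarrow> spread J \<epsilon> q \<le> real q powr (- c)"
    and S: "\<And>s::nat. \<delta> \<le> real s powr (- c) \<Longrightarrow> real s \<le> S"
    and Y: "N * (2 * real J * (S * (real n * N + 1))) + 2 * real J * S * N \<le> Y"
  obtains s t :: nat where "1 \<le> s" "real s \<le> S" "2 ^ t \<le> s"
    "card {i \<in> {1..n}. int s * v i \<notin> bounded_combs (real s * N) bs} \<le> K * (length bs + t + 2)"
proof -
  define G where "G i \<longleftrightarrow> (\<exists>D::nat. 1 \<le> D \<and> real D \<le> N \<and> int D * v i \<in> bounded_combs N bs)" for i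
  define P where "P t \<longleftrightarrow> (\<exists>us s I. length us = t \<and> I \<subseteq> I0 \<and> replaced I (us @ bs) \<and> 1 \<le> s \<and> 2 ^ t \<le> s \<and>
      (\<forall>u\<in>set us. int s * u \<in> bounded_combs (real s * N) bs) \<and>
      (\<forall>a. walk_weight J \<epsilon> (us @ bs) a \<le> real s powr (- c)))" for t
  have "P 0" unfolding P_def using I0 one
    by (intro exI[of _ "[]"] exI[of _ "1::nat"] exI[of _ I0]) auto
  have bound: "t \<le> n" if "P t" for t
    using that replaced_length unfolding P_def by fastforce
  define t where "t = (GREATEST t. P t)"
  have t: "P t" and max: "\<And>t'. P t' \<Longrightarrow> t' \<le> t"
    unfolding t_def using GreatestI_nat[of P 0 n, OF \<open>P 0\<close>] Greatest_le_nat[of P _ n] bound by auto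
  obtain us s I where us: "length us = t" "I \<subseteq> I0" "replaced I (us @ bs)" "1 \<le> s" "2 ^ t \<le> s"
      "\<And>u. u \<in> set us \<Longrightarrow> int s * u \<in> bounded_combs (real s * N) bs"
      "\<And>a. walk_weight J \<epsilon> (us @ bs) a \<le> real s powr (- c)"
    using t unfolding P_def by blast
  have sS: "real s \<le> S"
    using replaced_walk_weight[OF us(3)] us(7)[of 0] by (intro S) linarith
  define B where "B = {i \<in> I. G i \<and> int s * v i \<notin> bounded_combs (real s * N) bs}"
  have cardB: "card B < K"
  proof (rule ccontr)
    assume "\<not> card B < K"
    then have "B \<subseteq> I" "K \<le> card B" by (auto simp: B_def)
    then obtain b I' where b: "b \<in> B" "I' \<subseteq> I" "replaced I' (v b # us @ bs)"
      by (rule replaced_extend[OF us(3)])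
    define u where "u = v b"
    obtain D :: nat where D: "1 \<le> D" "real D \<le> N" "int D * u \<in> bounded_combs N bs"
      using b(1) by (auto simp: B_def G_def u_def)
    define Q where "Q m \<longleftrightarrow> 1 \<le> m \<and> int (m * s) * u \<in> bounded_combs (real (m * s) * N) bs" for m :: nat
    have "int s * (int D * u) \<in> bounded_combs (\<bar>real_of_int (int s)\<bar> * N) bs"
      by (intro bounded_combs_scale D)
    moreover have "\<bar>real_of_int (int s)\<bar> * N \<le> real (D * s) * N"
      using mult_right_mono[of 1 "real D" "real s"] D(1) N by (intro mult_right_mono) auto
    ultimately have "int s * (int D * u) \<in> bounded_combs (real (D * s) * N) bs"
      by (rule bounded_combs_mono)
    then have QD: "Q D" using D(1) by (simp add: Q_def mult_ac)
    \<comment> \<open>The order of \<open>s u\<close> modulo the lattice spanned by \<open>bs\<close>, if coordinates are identified with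
      elements.\<close>
    define q where "q = (LEAST m. Q m)"
    have q: "Q q" unfolding q_def by (rule LeastI[of Q, OF QD])
    have qmin: "q \<le> m" if "Q m" for m unfolding q_def by (rule Least_le[of Q, OF that])
    have "q \<noteq> 1" using q b(1) by (auto simp: Q_def B_def u_def)
    then have q2: "2 \<le> q" using q by (simp add: Q_def)
    have qN: "real q \<le> N" using qmin[OF QD] D(2) by linarith
    have walk: "walk_weight J \<epsilon> (u # us @ bs) a \<le> real (q * s) powr (- c)" for a
    proof -
      have "walk_weight J \<epsilon> (u # us @ bs) a \<le> real s powr (- c) * spread J \<epsilon> q"
      proof (rule walk_weight_Cons_le[OF us(7) eps_nonneg])
        show "1 \<le> q" using q2 by simp
        fix m :: nat
        assume m: "1 \<le> m" "m \<le> 2 * J" "int m * u \<in> bounded_combs (2 * real J) (us @ bs)"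
        \<comment> \<open>A relation between \<open>u\<close> and the selected elements is, after multiplication by \<open>s\<close>, one
          between \<open>u\<close> and \<open>bs\<close>; uniqueness of coordinates then makes \<open>m\<close> a candidate for \<open>q\<close>.\<close>
        let ?Z = "2 * real J * (real s * (real (length us) * N + 1))"
        have "int s * (int m * u) \<in> bounded_combs ?Z bs"
          using m(3) N by (intro bounded_combs_append_scaled us(6)) auto
        then have Z: "int (m * s) * u \<in> bounded_combs ?Z bs" by (simp add: mult_ac)
        have m2: "real m \<le> 2 * real J" using m(2) by linarith
        have len: "real (length us) \<le> real n" using replaced_length[OF us(3)] by simp
        have "real D * ?Z \<le> N * (2 * real J * (S * (real n * N + 1)))"
          using D(2) N sS len by (intro mult_mono add_mono) auto
        moreover have "real (m * s) * N \<le> 2 * real J * S * N"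
          using m2 sS N unfolding of_nat_mult by (intro mult_right_mono mult_mono) auto
        ultimately have "real D * ?Z + real (m * s) * N \<le> Y" using Y by linarith
        then have "int (m * s) * u \<in> bounded_combs (real (m * s) * N) bs"
          by (rule dissociated_multiple_coeff_bound[OF dis D(1,3) Z])
        then show "q \<le> m" using m(1) by (intro qmin) (simp add: Q_def)
      qed
      also have "\<dots> \<le> real s powr (- c) * real q powr (- c)"
        using gain[OF q2 qN] by (intro mult_left_mono) auto
      also have "\<dots> = real (q * s) powr (- c)" by (simp add: powr_mult mult.commute)
      finally show ?thesis .
    qed
    have "P (Suc t)" unfolding P_def
    proof (intro exI conjI ballI allI)
      show "length (u # us) = Suc t" using us(1) by simp
      show "I' \<subseteq> I0" using b us by blast
      show "replaced I' ((u # us) @ bs)" using b by (simp add: u_def)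
      show "1 \<le> q * s" using q2 us(4) by simp
      show "2 ^ Suc t \<le> q * s" using mult_le_mono[OF q2 us(5)] by simp
      show "walk_weight J \<epsilon> ((u # us) @ bs) a \<le> real (q * s) powr (- c)" for a using walk by simp
      fix w assume "w \<in> set (u # us)"
      then consider "w = u" | "w \<in> set us" by auto
      then show "int (q * s) * w \<in> bounded_combs (real (q * s) * N) bs"
      proof cases
        case 1
        then show ?thesis using q by (simp add: Q_def)
      next
        case 2
        then have "int q * (int s * w) \<in> bounded_combs (\<bar>real_of_int (int q)\<bar> * (real s * N)) bs"
          by (intro bounded_combs_scale us(6))
        then show ?thesis by (simp add: mult_ac)
      qed
    qed
    then have "Suc t \<le> t" by (rule max)
    then show False by simp
  qed
  let ?E = "{i \<in> {1..n}. int s * v i \<notin> bounded_combs (real s * N) bs}"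
  have I: "I \<subseteq> {1..n}" "card I + K * length (us @ bs) = n" using us(3) by (auto simp: replaced_def)
  have sub: "?E \<subseteq> ({1..n} - I) \<union> ({i \<in> I0. \<not> G i} \<union> B)" using us(2) by (auto simp: B_def)
  have fin: "finite I0" "finite I" using I I0 finite_subset unfolding replaced_def by blast+
  have "card ({1..n} - I) = K * length (us @ bs)"
    using I fin by (subst card_Diff_subset) auto
  moreover have "card ?E \<le> card ({1..n} - I) + (card {i \<in> I0. \<not> G i} + card B)"
  proof -
    have "card ?E \<le> card (({1..n} - I) \<union> ({i \<in> I0. \<not> G i} \<union> B))"
      using fin by (intro card_mono sub) (auto simp: B_def)
    then show ?thesis
      using card_Un_le[of "{1..n} - I" "{i \<in> I0. \<not> G i} \<union> B"] card_Un_le[of "{i \<in> I0. \<not> G i}" B] by linarith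
  qed
  moreover have "card {i \<in> I0. \<not> G i} < K" using few by (simp add: G_def)
  ultimately have "card ?E \<le> K * length (us @ bs) + (K + K)" using cardB by linarith
  also have "\<dots> = K * (length bs + t + 2)" using us(1) by (simp add: algebra_simps)
  finally show thesis using that[of s t] us sS by blast
qed

end

section \<open>The progression\<close>

lemma gap_of_scaled_combs:
  fixes bs :: "int list" and s :: nat and N :: real
  assumes s: "1 \<le> s" and N: "N \<ge> 0"
  defines "L \<equiv> \<lfloor>real s * N\<rfloor>"
  defines "Q \<equiv> \<lparr>gap_base = 0, gap_dims = map (\<lambda>b. (of_int b / of_nat s, - L, L)) bs\<rparr>"
  shows "is_gap Q" "gap_rank Q = length bs" "gap_volume Q = (2 * L + 1) ^ length bs"
    "\<And>j. j < length bs \<Longrightarrow> of_nat s * gap_gen Q j = of_int (bs ! j)"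
    "\<And>y. int s * y \<in> bounded_combs (real s * N) bs \<Longrightarrow> of_int y \<in> gap_set Q"
proof -
  have L: "L \<ge> 0" using N by (simp add: L_def)
  then show "is_gap Q" by (auto simp: is_gap_def Q_def)
  show rank: "gap_rank Q = length bs" by (simp add: gap_rank_def Q_def)
  have dims: "gap_gen Q j = of_int (bs ! j) / of_nat s" "gap_lo Q j = - L" "gap_hi Q j = L"
    if "j < length bs" for j
    using that by (simp_all add: gap_gen_def gap_lo_def gap_hi_def Q_def)
  then show "gap_volume Q = (2 * L + 1) ^ length bs"
    by (simp add: gap_volume_def rank)
  show "of_nat s * gap_gen Q j = of_int (bs ! j)" if "j < length bs" for j
    using dims(1)[OF that] s by simp
  fix y assume "int s * y \<in> bounded_combs (real s * N) bs"
  then obtain c where c: "\<forall>i<length bs. \<bar>real_of_int (c i)\<bar> \<le> real s * N" "int s * y = (\<Sum>i<length bs. c i * bs ! i)"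
    by (rule bounded_combsE)
  have cL: "- L \<le> c i" "c i \<le> L" if "i < length bs" for i
  proof -
    have "real_of_int \<bar>c i\<bar> \<le> real s * N" using c(1) that by simp
    then have "\<bar>c i\<bar> \<le> L" by (simp add: L_def le_floor_iff)
    then show "- L \<le> c i" "c i \<le> L" by linarith+
  qed
  have "of_nat s * (of_int y :: rat) = of_int (int s * y)" by simp
  also have "\<dots> = (\<Sum>i<length bs. of_int (c i) * of_int (bs ! i))" unfolding c(2) by simp
  finally have "of_int y = (\<Sum>i<length bs. of_int (c i) * (of_int (bs ! i) / of_nat s :: rat))"
    using s by (simp add: sum_divide_distrib[symmetric] field_simps)
  also have "\<dots> = (\<Sum>i<gap_rank Q. of_int (c i) * gap_gen Q i)"
    unfolding rank by (intro sum.cong refl) (simp add: dims)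
  also have "\<dots> = gap_base Q + \<dots>" by (simp add: Q_def)
  finally have "of_int y = gap_base Q + (\<Sum>i<gap_rank Q. of_int (c i) * gap_gen Q i)" .
  then show "of_int y \<in> gap_set Q"
    unfolding gap_set_def using cL by (auto simp: rank dims)
qed

section \<open>Choice of the parameters\<close>

lemma exp_minus_le_inverse_sqrt:
  assumes "J \<ge> 1"
  shows "exp (- real J) \<le> 1 / sqrt (real J)"
proof -
  have "sqrt (real J) \<le> real J" using assms by (simp add: real_le_lsqrt power2_eq_square)
  also have "\<dots> \<le> exp (real J)" using exp_ge_add_one_self[of "real J"] by linarith
  finally show ?thesis using assms by (simp add: exp_minus field_simps)
qed

lemma spread_le:
  fixes y :: real
  assumes y: "y > 0" "y ^ 4 \<le> real J" and q: "q \<ge> 1" and J: "J \<ge> 1"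
  shows "spread J (exp (- real J)) q \<le> 4 / y\<^sup>2 + (1 + 1 / y\<^sup>2) / real q"
proof -
  have "y\<^sup>2 = sqrt (y ^ 4)"
    using y(1) by (intro real_sqrt_unique[symmetric]) (auto simp: power_mult[symmetric])
  also have "\<dots> \<le> sqrt (real J)" using y(2) by (rule real_sqrt_le_mono)
  finally have inv: "1 / sqrt (real J) \<le> 1 / y\<^sup>2" using y(1) by (intro frac_le) auto
  have e: "exp (- real J) \<le> 1 / y\<^sup>2" using exp_minus_le_inverse_sqrt[OF J] inv by linarith
  have "step_weight J (exp (- real J)) 0 \<le> 2 / y\<^sup>2"
    using step_weight_0_le[OF J, of "exp (- real J)"] inv e by simp
  moreover have "(1 + exp (- real J)) / real q \<le> (1 + 1 / y\<^sup>2) / real q"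
    using e by (intro divide_right_mono) auto
  ultimately show ?thesis by (simp add: spread_def)
qed

lemma spread_le_large:
  fixes y :: real
  assumes y: "y \<ge> 40" "y ^ 4 \<le> real J" and q: "y\<^sup>2 \<le> real q"
  shows "spread J (exp (- real J)) q \<le> 1 / y"
proof -
  have y2: "y\<^sup>2 \<ge> 1" "y ^ 4 \<ge> 1" using y(1) by (auto intro!: one_le_power)
  have "J \<ge> 1" "q \<ge> 1" using y2 y(2) q by linarith+
  then have "spread J (exp (- real J)) q \<le> 4 / y\<^sup>2 + (1 + 1 / y\<^sup>2) / real q"
    using y by (intro spread_le) auto
  also have "(1 + 1 / y\<^sup>2) / real q \<le> 2 / y\<^sup>2"
    using y2 q by (intro frac_le) (auto simp: divide_le_eq_1)
  also have "4 / y\<^sup>2 + 2 / y\<^sup>2 \<le> 1 / y"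
    using y(1) by (simp add: field_simps power2_eq_square)
  finally show ?thesis by simp
qed

text \<open>For \<open>q < y\<^sup>2\<close> even \<open>q powr (- 1 / 2)\<close> is a bound: \<open>1 / q\<close> is at most \<open>3 / 4\<close> of it because \<open>q \<ge> 2\<close>,
  which leaves room for the error terms. For larger \<open>q\<close> the weight is at most \<open>1 / y\<close>, hence at most
  \<open>N powr (- c)\<close>, and \<open>q \<le> N\<close>.\<close>
lemma spread_le_powr:
  fixes y c N :: real
  assumes y: "y \<ge> 40" "y ^ 4 \<le> real J" and q: "2 \<le> q" "real q \<le> N"
    and c: "0 \<le> c" "c \<le> 1 / 2" and N: "1 / y \<le> N powr (- c)"
  shows "spread J (exp (- real J)) q \<le> real q powr (- c)"
proof (cases "y\<^sup>2 \<le> real q")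
  case True
  have "spread J (exp (- real J)) q \<le> 1 / y" by (rule spread_le_large[OF y True])
  also have "\<dots> \<le> N powr (- c)" by (rule N)
  also have "\<dots> \<le> real q powr (- c)" using q c by (intro powr_mono2') auto
  finally show ?thesis .
next
  case False
  let ?z = "sqrt (real q)"
  have "y ^ 4 \<ge> 1" using y(1) by (auto intro!: one_le_power)
  then have J: "J \<ge> 1" using y(2) by linarith
  have z: "?z > 0" "?z * ?z = real q" using q by auto
  have zy: "?z \<le> y" using False y(1) by (intro real_le_lsqrt) auto
  have z2: "7 / 5 \<le> ?z" using q(1) by (intro real_le_rsqrt) (auto simp: power2_eq_square)
  have "spread J (exp (- real J)) q \<le> 4 / y\<^sup>2 + (1 + 1 / y\<^sup>2) / real q"
    using y q J by (intro spread_le) auto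
  also have "4 / y\<^sup>2 \<le> (1 / ?z) * (1 / 10)"
  proof -
    have "4 / y\<^sup>2 = (1 / y) * (4 / y)" by (simp add: power2_eq_square)
    also have "\<dots> \<le> (1 / ?z) * (1 / 10)"
    proof (rule mult_mono)
      show "1 / y \<le> 1 / ?z" using zy z(1) by (intro frac_le) auto
      show "4 / y \<le> 1 / 10" using y(1) by (simp add: field_simps)
    qed (use y(1) in auto)
    finally show ?thesis .
  qed
  also have "(1 + 1 / y\<^sup>2) / real q \<le> (1 / ?z) * (3 / 4)"
  proof -
    have "y\<^sup>2 \<ge> 40" using y(1) by (smt (verit) one_le_power power2_eq_square mult_le_cancel_left1)
    have "1 / y\<^sup>2 \<le> 1 / 40" using \<open>y\<^sup>2 \<ge> 40\<close> by (intro divide_left_mono) auto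
    then have "(1 + 1 / y\<^sup>2) / ?z \<le> (41 / 40) / (7 / 5)" using z2 by (intro frac_le) auto
    also have "\<dots> \<le> 3 / 4" by simp
    finally have "(1 / ?z) * ((1 + 1 / y\<^sup>2) / ?z) \<le> (1 / ?z) * (3 / 4)"
      using z(1) by (intro mult_left_mono) auto
    then show ?thesis using z(2) by (simp add: divide_divide_eq_left')
  qed
  also have "(1 / ?z) * (1 / 10) + (1 / ?z) * (3 / 4) \<le> 1 / ?z" using z(1) by (simp add: field_simps)
  also have "1 / ?z = real q powr (- (1 / 2))"
    using q(1) by (simp add: powr_minus powr_half_sqrt inverse_eq_divide)
  also have "\<dots> \<le> real q powr (- c)" using q(1) c by (intro powr_mono) auto
  finally show ?thesis by simp
qed

text \<open>The reciprocal of the exponent \<open>c\<close> with which denominators up to \<open>N = n powr B\<close> are paid for: it gives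
  both \<open>c \<le> 1 / 2\<close> and \<open>N powr (- c) \<ge> n powr (- \<beta> / 4)\<close>, the two requirements of
  \<open>spread_le_powr\<close> for \<open>y = n powr (\<beta> / 4)\<close>.\<close>
definition height_ratio :: "real \<Rightarrow> real \<Rightarrow> real" where
  "height_ratio \<beta> B = 2 + 4 * B / \<beta>"

text \<open>If the relations have size \<open>N = n powr B\<close> and common denominators are at most
  \<open>S = n powr (A * height_ratio \<beta> B)\<close>, then relations of size about \<open>n * J * S * N\<^sup>2\<close>, with \<open>J\<close> about
  \<open>n powr \<beta>\<close>, have to be excluded one level above.\<close>
primrec scale_exponent :: "real \<Rightarrow> real \<Rightarrow> nat \<Rightarrow> real" where
  "scale_exponent A \<beta> 0 = \<beta> + 1"
| "scale_exponent A \<beta> (Suc i) =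
     2 * scale_exponent A \<beta> i + A * height_ratio \<beta> (scale_exponent A \<beta> i) + \<beta> + 3"

lemma scale_exponent_ge:
  assumes "A > 0" "\<beta> > 0"
  shows "\<beta> + 1 \<le> scale_exponent A \<beta> i"
  using assms by (induction i) (auto simp: height_ratio_def intro!: add_nonneg_nonneg)

lemma scale_exponent_mono:
  assumes "A > 0" "\<beta> > 0" "i \<le> j"
  shows "scale_exponent A \<beta> i \<le> scale_exponent A \<beta> j"
proof (rule lift_Suc_mono_le[OF _ assms(3)])
  fix i
  let ?B = "scale_exponent A \<beta> i"
  have B: "0 \<le> ?B" using scale_exponent_ge[OF assms(1,2), of i] assms by linarith
  then have "0 \<le> A * height_ratio \<beta> ?B" using assms by (simp add: height_ratio_def)
  then show "?B \<le> scale_exponent A \<beta> (Suc i)" using B assms by simp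
qed

lemma height_ratio_mono: "\<beta> > 0 \<Longrightarrow> B \<le> B' \<Longrightarrow> height_ratio \<beta> B \<le> height_ratio \<beta> B'"
  by (simp add: height_ratio_def divide_right_mono)

section \<open>Large concentration forces bounded rank\<close>

text \<open>The parameters are \<open>J\<close> about \<open>n powr \<beta>\<close>, \<open>\<epsilon> = exp (- J)\<close> and \<open>K\<close> about \<open>4 J / \<mu>\<close>. The bound on \<open>d\<close>
  is what makes \<open>d\<close> dissociated elements incompatible with concentration: each of them costs a factor
  \<open>n powr (- \<beta> / 4)\<close>. The exceptional set has size \<open>O(K log n)\<close> with a constant depending on \<open>\<mu>\<close>, and
  the surplus powers of \<open>n powr \<beta>\<close> absorb the logarithm and the constant.\<close>
lemma concentration_imp_scaled_combs:
  fixes A \<beta> \<mu> :: real and n d :: nat and v :: "nat \<Rightarrow> int"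
  defines "Bmax \<equiv> scale_exponent A \<beta> d"
  defines "\<kappa>max \<equiv> height_ratio \<beta> Bmax"
  assumes A: "A > 0" and \<beta>: "\<beta> > 0" and \<mu>: "0 < \<mu>" "\<mu> \<le> 1" and d: "4 * A < \<beta> * real d"
    and n: "n \<ge> 4" "real n powr (\<beta> / 4) \<ge> 40"
    and C: "9 / \<mu> * (real d + 2 + 2 * A * \<kappa>max / \<beta>) \<le> real n powr \<beta>"
    and conc: "real n powr (- A) \<le> conc_prob \<mu> n v"
  obtains bs :: "int list" and s :: nat and B :: real where
    "length bs < d" "set bs \<subseteq> v ` {1..n}" "1 \<le> s" "real s \<le> real n powr (A * \<kappa>max)" "0 \<le> B" "B \<le> Bmax"
    "real (card {i \<in> {1..n}. int s * v i \<notin> bounded_combs (real s * real n powr B) bs}) \<le> real n powr (4 * \<beta>)"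
proof -
  define J where "J = nat \<lceil>real n powr \<beta>\<rceil>"
  define \<epsilon> where "\<epsilon> = exp (- real J)"
  define K where "K = nat \<lceil>4 * real J / \<mu>\<rceil>"
  define M where "M = 2 * nat (int J * (int n * (\<Sum>i=1..n. \<bar>v i\<bar>))) + 1"
  define \<delta> where "\<delta> = real n powr (- A)"
  define y where "y = real n powr (\<beta> / 4)"
  have n1: "real n \<ge> 4" "real n > 1" using n(1) by linarith+
  have np: "1 \<le> real n powr \<beta>" using n1 \<beta> by (intro ge_one_powr_ge_zero) auto
  have J: "real n powr \<beta> \<le> real J" "real J \<le> 2 * real n powr \<beta>"
    using np unfolding J_def by linarith+
  have J1: "J \<ge> 1" using J(1) np by linarith
  have y: "y \<ge> 40" "y ^ 4 \<le> real J"
    using n J n1 by (auto simp: y_def powr_power)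
  have K: "4 * real J / \<mu> \<le> real K" "real K \<le> 4 * real J / \<mu> + 1"
    using \<mu> by (auto simp: K_def)
  interpret concentrated_sum n v \<mu> \<epsilon> \<delta> J K M
  proof
    have "0 < 4 * real J / \<mu>" using J1 \<mu> by simp
    then show "1 \<le> K" using K(1) by linarith
    show "4 * real J \<le> real K * \<mu>" using K(1) \<mu> by (simp add: field_simps)
    have "0 \<le> int J * (int n * (\<Sum>i=1..n. \<bar>v i\<bar>))" by (intro mult_nonneg_nonneg sum_nonneg) auto
    then show "int J * (int n * (\<Sum>i=1..n. \<bar>v i\<bar>)) < int M" by (simp add: M_def)
  qed (use \<mu> conc in \<open>auto simp: \<epsilon>_def M_def \<delta>_def\<close>)
  have spread1: "spread J \<epsilon> (2 * J + 1) \<le> 1 / y"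
  proof -
    have "y\<^sup>2 \<le> y ^ 4" using y(1) by (intro power_increasing) auto
    then have "y\<^sup>2 \<le> real (2 * J + 1)" using y(2) by simp
    then show ?thesis unfolding \<epsilon>_def using y by (intro spread_le_large) auto
  qed
  have spread0: "spread J \<epsilon> (2 * J + 1) \<ge> 0"
    using step_weight_nonneg[OF eps_nonneg] eps_nonneg by (simp add: spread_def)
  define X where "X r = real n powr scale_exponent A \<beta> (d - r)" for r
  have twoJ: "2 * real J \<le> real n powr (\<beta> + 1)"
  proof -
    have "2 * real J \<le> 4 * real n powr \<beta>" using J by simp
    also have "\<dots> \<le> real n * real n powr \<beta>" using n1 by (intro mult_right_mono) auto
    also have "\<dots> = real n powr (\<beta> + 1)" using n1 by (simp add: powr_add)
    finally show ?thesis .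
  qed
  have X_ge: "2 * real J \<le> X r" for r
  proof -
    have "real n powr (\<beta> + 1) \<le> X r"
      unfolding X_def using n1 scale_exponent_ge[OF A \<beta>] by (intro powr_mono) auto
    then show ?thesis using twoJ by linarith
  qed
  obtain I bs where bs: "length bs < d" "replaced I bs" "dissociated (X (length bs)) bs"
    "card {i \<in> I. \<not> (\<exists>D::nat. 1 \<le> D \<and> real D \<le> X (Suc (length bs)) \<and>
        int D * v i \<in> bounded_combs (X (Suc (length bs))) bs)} < K"
  proof (rule exists_maximal_dissociated[of d X])
    show "X (Suc r) \<le> X r" for r
      unfolding X_def using n1 by (intro powr_mono scale_exponent_mono A \<beta>) auto
    show "2 * real J \<le> X d" by (rule X_ge)
    have "spread J \<epsilon> (2 * J + 1) ^ d \<le> (1 / y) ^ d" using spread1 spread0 by (rule power_mono)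
    also have "\<dots> = real n powr (- (\<beta> / 4 * real d))"
      using n1 by (simp add: y_def powr_minus powr_power power_one_over inverse_eq_divide mult_ac)
    also have "\<dots> < \<delta>" unfolding \<delta>_def using n1 d by (intro powr_less_mono) auto
    finally show "spread J \<epsilon> (2 * J + 1) ^ d < \<delta>" .
  qed
  define B where "B = scale_exponent A \<beta> (d - Suc (length bs))"
  define \<kappa> where "\<kappa> = height_ratio \<beta> B"
  define N where "N = real n powr B"
  define S where "S = real n powr (A * \<kappa>)"
  have XN: "X (Suc (length bs)) = N" by (simp add: X_def N_def B_def)
  have B0: "B > 0" using scale_exponent_ge[OF A \<beta>, of "d - Suc (length bs)"] \<beta> by (simp add: B_def)
  have Bmax: "B \<le> Bmax" unfolding B_def Bmax_def by (intro scale_exponent_mono A \<beta>) auto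
  have \<kappa>: "\<kappa> \<ge> 2" "\<kappa> \<le> \<kappa>max"
    using B0 \<beta> height_ratio_mono[OF \<beta> Bmax] by (simp_all add: \<kappa>_def \<kappa>max_def) (simp add: height_ratio_def)
  have N1: "N \<ge> 1" unfolding N_def using n1 B0 by (intro ge_one_powr_ge_zero) auto
  have S1: "S \<ge> 1" unfolding S_def using n1 A \<kappa> by (intro ge_one_powr_ge_zero) auto
  have XY: "X (length bs) = real n powr (2 * B + A * \<kappa> + \<beta> + 3)"
    using bs(1) by (simp add: X_def B_def \<kappa>_def Suc_diff_Suc[symmetric])
  obtain s t :: nat where st: "1 \<le> s" "real s \<le> S" "2 ^ t \<le> s"
    "card {i \<in> {1..n}. int s * v i \<notin> bounded_combs (real s * N) bs} \<le> K * (length bs + t + 2)"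
  proof (rule exists_common_denominator[OF bs(2,3), where N = N and c = "1 / \<kappa>" and S = S])
    fix a
    have "walk_weight J \<epsilon> bs a \<le> spread J \<epsilon> (2 * J + 1) ^ length bs"
      by (rule walk_weight_dissociated_le[OF bs(3) X_ge eps_nonneg])
    also have "\<dots> \<le> 1"
    proof (rule power_le_one[OF spread0])
      have "1 / y \<le> 1" using y(1) by simp
      then show "spread J \<epsilon> (2 * J + 1) \<le> 1" using spread1 by linarith
    qed
    finally show "walk_weight J \<epsilon> bs a \<le> 1" .
  next
    show "card {i \<in> I. \<not> (\<exists>D::nat. 1 \<le> D \<and> real D \<le> N \<and> int D * v i \<in> bounded_combs N bs)} < K"
      using bs(4) by (simp add: XN)
  next
    fix q :: nat assume q: "2 \<le> q" "real q \<le> N"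
    show "spread J \<epsilon> q \<le> real q powr (- (1 / \<kappa>))"
      unfolding \<epsilon>_def
    proof (rule spread_le_powr[OF y q])
      show "1 / \<kappa> \<le> 1 / 2" "0 \<le> 1 / \<kappa>" using \<kappa>(1) by (auto intro: divide_left_mono)
      have "B / \<kappa> \<le> \<beta> / 4"
        using B0 \<beta> by (simp add: \<kappa>_def height_ratio_def field_simps)
      then have "real n powr (- (\<beta> / 4)) \<le> real n powr (- (B / \<kappa>))" using n1 by (intro powr_mono) auto
      then show "1 / y \<le> N powr (- (1 / \<kappa>))"
        using n1 by (simp add: y_def N_def powr_powr powr_minus_divide)
    qed
  next
    fix s :: nat assume s: "\<delta> \<le> real s powr (- (1 / \<kappa>))"
    show "real s \<le> S"
    proof (cases "s = 0")
      case False
      have "(real s powr (- (1 / \<kappa>))) powr (- \<kappa>) \<le> \<delta> powr (- \<kappa>)"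
        using \<kappa>(1) s n1 by (intro powr_mono2') (auto simp: \<delta>_def)
      then show ?thesis using \<kappa>(1) False by (simp add: powr_powr \<delta>_def S_def)
    qed (simp add: S_def)
  next
    have nN: "1 \<le> real n * N" using n1 N1 mult_mono[of 1 "real n" 1 N] by simp
    have "N * (2 * real J * (S * (real n * N + 1))) + 2 * real J * S * N =
        (2 * real J * S * N) * (real n * N + 2)" by (simp add: algebra_simps)
    also have "\<dots> \<le> (4 * real n powr \<beta> * S * N) * (3 * (real n * N))"
    proof (rule mult_mono)
      show "2 * real J * S * N \<le> 4 * real n powr \<beta> * S * N"
        using J(2) S1 N1 by (intro mult_right_mono) auto
      show "real n * N + 2 \<le> 3 * (real n * N)" using nN by linarith
    qed (use S1 N1 in auto)
    also have "\<dots> = 12 * (real n powr \<beta> * S * N * real n * N)" by (simp add: mult_ac)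
    also have "\<dots> \<le> (real n * real n) * (real n powr \<beta> * S * N * real n * N)"
      using n1 S1 N1 mult_mono[of 4 "real n" 4 "real n"] by (intro mult_right_mono) auto
    also have "\<dots> = real n powr (1 + 1 + \<beta> + A * \<kappa> + B + 1 + B)"
      unfolding S_def N_def powr_add using n1 by (simp add: mult_ac)
    also have "\<dots> = X (length bs)"
      unfolding XY by (rule arg_cong[where f = "\<lambda>e. real n powr e"]) simp
    finally show "N * (2 * real J * (S * (real n * N + 1))) + 2 * real J * S * N \<le> X (length bs)" .
  qed (use N1 in auto)
  have t: "real t \<le> 2 * A * \<kappa>max / \<beta> * real n powr \<beta>"
  proof -
    have "2 ^ t \<le> S" using st(2,3) by (metis of_nat_le_iff of_nat_numeral of_nat_power order_trans)
    then have "ln (2 ^ t) \<le> ln S" using S1 by simp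
    then have "real t * ln 2 \<le> A * \<kappa> * ln (real n)" using n1 by (simp add: ln_realpow S_def)
    moreover have "real t * (1 / 2) \<le> real t * ln 2" using ln2_ge_two_thirds by (intro mult_left_mono) auto
    moreover have "A * \<kappa> * ln (real n) \<le> A * \<kappa>max * (real n powr \<beta> / \<beta>)"
      using n1 A \<kappa> \<beta> by (intro mult_mono ln_powr_bound) auto
    ultimately show ?thesis by simp
  qed
  have "real (card {i \<in> {1..n}. int s * v i \<notin> bounded_combs (real s * N) bs}) \<le> real (K * (length bs + t + 2))"
    using st(4) by (rule of_nat_mono)
  also have "\<dots> = real K * (real (length bs) + real t + 2)" by (simp add: algebra_simps)
  also have "\<dots> \<le> (9 / \<mu> * real n powr \<beta>) * ((real d + 2 + 2 * A * \<kappa>max / \<beta>) * real n powr \<beta>)"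
  proof (intro mult_mono)
    have "1 \<le> real n powr \<beta> / \<mu>" using np \<mu> by (simp add: le_divide_eq)
    moreover have "4 * real J / \<mu> \<le> 8 * real n powr \<beta> / \<mu>" using J(2) \<mu> by (intro divide_right_mono) auto
    ultimately show "real K \<le> 9 / \<mu> * real n powr \<beta>" using K(2) by simp
    have "real (length bs) + 2 \<le> (real d + 2) * real n powr \<beta>"
      using bs(1) np mult_mono[of "real (length bs) + 2" "real d + 2" 1 "real n powr \<beta>"] by simp
    then show "real (length bs) + real t + 2 \<le> (real d + 2 + 2 * A * \<kappa>max / \<beta>) * real n powr \<beta>"
      using t by (simp add: ring_distribs)
  qed (use \<mu> in auto)
  also have "\<dots> = (9 / \<mu> * (real d + 2 + 2 * A * \<kappa>max / \<beta>)) * (real n powr \<beta> * real n powr \<beta>)"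
    by (simp add: mult_ac)
  also have "\<dots> \<le> real n powr \<beta> * (real n powr \<beta> * real n powr \<beta>)"
    by (intro mult_right_mono C) auto
  also have "\<dots> = real n powr (3 * \<beta>)" by (simp flip: powr_add)
  also have "\<dots> \<le> real n powr (4 * \<beta>)" using n1 \<beta> by (intro powr_mono) auto
  finally have "real (card {i \<in> {1..n}. int s * v i \<notin> bounded_combs (real s * N) bs}) \<le> real n powr (4 * \<beta>)" .
  moreover have "real s \<le> real n powr (A * \<kappa>max)"
  proof -
    have "S \<le> real n powr (A * \<kappa>max)"
      unfolding S_def using n1 A \<kappa> by (intro powr_mono mult_left_mono) auto
    then show ?thesis using st(2) by linarith
  qed
  ultimately show thesis
    using that[of bs s B] bs(1,2) st(1) B0 Bmax by (simp add: N_def replaced_def)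
qed

theorem corollary2p7:
  fixes A \<alpha> :: real
  assumes "A > 0" and "\<alpha> > 0"
  shows "\<exists>A'::real. A' > 0 \<and>
    (\<forall>\<mu>::real. 0 < \<mu> \<and> \<mu> \<le> 1 \<longrightarrow>
      (\<forall>\<^sub>F n::nat in sequentially. \<forall>v :: nat \<Rightarrow> int.
        conc_prob \<mu> n v \<ge> real n powr (- A) \<longrightarrow>
        (\<exists>Q. is_gap Q \<and> real (gap_rank Q) \<le> A' \<and>
             real_of_int (gap_volume Q) \<le> real n powr A' \<and>
             real (card {i \<in> {1..n}. rat_of_int (v i) \<notin> gap_set Q}) \<le> real n powr \<alpha> \<and>
             (\<exists>s::nat. 0 < s \<and> real s \<le> real n powr A' \<and>
                (\<forall>j<gap_rank Q. \<exists>i\<in>{1..n}. of_nat s * gap_gen Q j = rat_of_int (v i))))))"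
proof -
  define \<beta> where "\<beta> = \<alpha> / 4"
  define d where "d = nat \<lceil>4 * A / \<beta>\<rceil> + 1"
  define Bm where "Bm = scale_exponent A \<beta> d"
  define \<kappa> where "\<kappa> = height_ratio \<beta> Bm"
  define A' where "A' = real d * (A * \<kappa> + Bm + 1)"
  have \<beta>: "\<beta> > 0" using assms by (simp add: \<beta>_def)
  have "4 * A / \<beta> < real d" unfolding d_def by linarith
  then have d: "4 * A < \<beta> * real d" using \<beta> by (simp add: field_simps)
  have d1: "real d \<ge> 1" by (simp add: d_def)
  have Bm: "Bm > 0" using scale_exponent_ge[OF assms(1) \<beta>, of d] \<beta> by (simp add: Bm_def)
  have \<kappa>: "\<kappa> > 0" using Bm \<beta> by (simp add: \<kappa>_def height_ratio_def add_pos_pos)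
  have E: "A * \<kappa> + Bm + 1 \<ge> 1" using Bm \<kappa> assms by simp
  have "real d * 1 \<le> A'" unfolding A'_def by (rule mult_left_mono[OF E]) simp
  moreover have "A * \<kappa> + Bm + 1 \<le> A'"
    using mult_right_mono[OF d1, of "A * \<kappa> + Bm + 1"] E unfolding A'_def mult_1 by linarith
  ultimately have A'_ge: "A' \<ge> real d" "A' \<ge> A * \<kappa>" using Bm by linarith+
  show ?thesis
  proof (intro exI[of _ A'] conjI allI impI)
    show "A' > 0" using A'_ge d1 by linarith
    fix \<mu> :: real assume \<mu>: "0 < \<mu> \<and> \<mu> \<le> 1"
    have large: "\<forall>\<^sub>F n::nat in sequentially. C \<le> real n powr \<gamma>" if "\<gamma> > 0" for C \<gamma> :: real
      using that by real_asymp
    show "\<forall>\<^sub>F n::nat in sequentially. \<forall>v :: nat \<Rightarrow> int.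
        conc_prob \<mu> n v \<ge> real n powr (- A) \<longrightarrow>
        (\<exists>Q. is_gap Q \<and> real (gap_rank Q) \<le> A' \<and>
             real_of_int (gap_volume Q) \<le> real n powr A' \<and>
             real (card {i \<in> {1..n}. rat_of_int (v i) \<notin> gap_set Q}) \<le> real n powr \<alpha> \<and>
             (\<exists>s::nat. 0 < s \<and> real s \<le> real n powr A' \<and>
                (\<forall>j<gap_rank Q. \<exists>i\<in>{1..n}. of_nat s * gap_gen Q j = rat_of_int (v i))))"
      using eventually_ge_at_top[of "4::nat"] large[of "\<beta> / 4" 40, OF divide_pos_pos[OF \<beta> zero_less_numeral]]
        large[of "\<beta>" "9 / \<mu> * (real d + 2 + 2 * A * \<kappa> / \<beta>)", OF \<beta>]
    proof eventually_elim
      case (elim n)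
      have n1: "real n \<ge> 4" using elim(1) by linarith
      show ?case
      proof (intro allI impI)
        fix v :: "nat \<Rightarrow> int"
        assume conc: "real n powr (- A) \<le> conc_prob \<mu> n v"
        obtain bs :: "int list" and s :: nat and B :: real where Q:
          "length bs < d" "set bs \<subseteq> v ` {1..n}" "1 \<le> s" "real s \<le> real n powr (A * \<kappa>)" "0 \<le> B" "B \<le> Bm"
          "real (card {i \<in> {1..n}. int s * v i \<notin> bounded_combs (real s * real n powr B) bs}) \<le> real n powr (4 * \<beta>)"
          by (rule concentration_imp_scaled_combs[OF assms(1) \<beta> conjunct1[OF \<mu>] conjunct2[OF \<mu>] d elim(1,2)
                elim(3)[unfolded \<kappa>_def Bm_def] conc, folded Bm_def, folded \<kappa>_def])
        define L where "L = \<lfloor>real s * real n powr B\<rfloor>"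
        define Q where "Q = \<lparr>gap_base = 0, gap_dims = map (\<lambda>b. (rat_of_int b / of_nat s, - L, L)) bs\<rparr>"
        note gap = gap_of_scaled_combs[where s = s and N = "real n powr B" and bs = bs, OF Q(3), folded L_def, folded Q_def, simplified]
        have vol: "real_of_int (gap_volume Q) \<le> real n powr A'"
        proof -
          have sN: "1 \<le> real s * real n powr B"
            using Q(3,5) n1 mult_mono[of 1 "real s" 1 "real n powr B"] by (simp add: ge_one_powr_ge_zero)
          have "real_of_int (2 * L + 1) \<le> 3 * (real s * real n powr B)"
          proof -
            have "real_of_int L \<le> real s * real n powr B" unfolding L_def by (rule of_int_floor_le)
            then show ?thesis using sN by simp
          qed
          also have "\<dots> \<le> real n * (real n powr (A * \<kappa>) * real n powr Bm)"
            using Q(4,6) n1 by (intro mult_mono powr_mono) auto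
          also have "\<dots> = real n powr (A * \<kappa> + Bm + 1)" using n1 by (simp add: powr_add)
          finally have le: "real_of_int (2 * L + 1) \<le> real n powr (A * \<kappa> + Bm + 1)" .
          have "L \<ge> 0" using sN by (simp add: L_def)
          then have "real_of_int (gap_volume Q) \<le> (real n powr (A * \<kappa> + Bm + 1)) ^ length bs"
            unfolding gap(3) of_int_power by (intro power_mono le) auto
          also have "\<dots> = real n powr ((A * \<kappa> + Bm + 1) * real (length bs))"
            using n1 by (simp add: powr_powr[symmetric] powr_realpow)
          also have "\<dots> \<le> real n powr A'"
            unfolding A'_def mult.commute[of "real d"] using Q(1) E n1 by (intro powr_mono mult_left_mono) auto
          finally show ?thesis .
        qed
        have "{i \<in> {1..n}. rat_of_int (v i) \<notin> gap_set Q} \<subseteq>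
            {i \<in> {1..n}. int s * v i \<notin> bounded_combs (real s * real n powr B) bs}"
          using gap(5) by auto
        then have "card {i \<in> {1..n}. rat_of_int (v i) \<notin> gap_set Q} \<le>
            card {i \<in> {1..n}. int s * v i \<notin> bounded_combs (real s * real n powr B) bs}"
          by (intro card_mono) auto
        then have "real (card {i \<in> {1..n}. rat_of_int (v i) \<notin> gap_set Q}) \<le> real n powr \<alpha>"
          using Q(7) by (simp add: \<beta>_def)
        moreover have "\<exists>i\<in>{1..n}. of_nat s * gap_gen Q j = rat_of_int (v i)" if "j < gap_rank Q" for j
        proof -
          have j: "j < length bs" using that gap(2) by simp
          then obtain i where "i \<in> {1..n}" "bs ! j = v i" using Q(2) nth_mem by blast
          then show ?thesis using gap(4)[OF j] by auto
        qed
        moreover have "real s \<le> real n powr A'"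
          by (rule order_trans[OF Q(4) powr_mono[OF A'_ge(2)]]) (use n1 in simp)
        moreover have "real (gap_rank Q) \<le> A'" using gap(2) Q(1) A'_ge(1) by simp
        ultimately show "\<exists>Q. is_gap Q \<and> real (gap_rank Q) \<le> A' \<and>
               real_of_int (gap_volume Q) \<le> real n powr A' \<and>
               real (card {i \<in> {1..n}. rat_of_int (v i) \<notin> gap_set Q}) \<le> real n powr \<alpha> \<and>
               (\<exists>s::nat. 0 < s \<and> real s \<le> real n powr A' \<and>
                  (\<forall>j<gap_rank Q. \<exists>i\<in>{1..n}. of_nat s * gap_gen Q j = rat_of_int (v i)))"
          using gap(1) vol Q(3) by (intro exI[of _ Q] conjI exI[of _ s]) auto
      qed
    qed
  qed
qed

end
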